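(* Let $G$ be a graph and $r,k\in\mathbb N$ with $\mathrm{pmw}_{6r+1}(G)=k$. Then $\mathrm{mw}_r(G)\le k\cdot\pi_G(k)$. Moreover, $G$ has a $6$-firm merge sequence of radius-$r$ width at most $k\cdot\pi_G(k)$, and such a sequence can be computed in polynomial time given $G$ and a sequence of partitions witnessing $\mathrm{pmw}_{6r+1}(G)\le k$.
   Context: Graphs are finite, simple, undirected; $\overline G$ is the edge-complement of $G$. The neighbourhood complexity of $G$ is $\pi_G(m)=\max_{A\subseteq V(G),|A|\le m}|\{N(v)\cap A: v\in V(G)\}|$. For a partition $\mathcal P$ of $V(G)$ and $X\subseteq V(G)$, $X/\mathcal P$ is the set of parts intersecting $X$. For $R\subseteq\binom{V(G)}2$, $\mathrm{Ball}^r_R(v)$ is the radius-$r$ ball in $(V(G),R)$. $\mathcal P$ is homogeneous modulo $R$ if for all parts $X,Y$ (possibly equal), the pairs $\{x,y\}$ with $x\in X,y\in Y,x\neq y,\{x,y\}\notin R$ are all edges of $G$ or all non-edges. A merge sequence for $G$ is $(\mathcal P_1,R_1),\dots,(\mathcal P_m,R_m)$ with $\mathcal P_1\preceq\dots\preceq\mathcal P_m$ partitions of $V(G)$ (each coarser or equal to the previous), $\mathcal P_1$ into singletons, $\mathcal P_m=\{V(G)\}$, $R_1\subseteq\dots\subseteq R_m\subseteq\binom{V(G)}2$, $\mathcal P_t$ homogeneous modulo $R_t$. Its radius-$r$ width is $\max_{t<m}\max_v|\mathrm{Ball}^r_{R_{t+1}}(v)/\mathcal P_t|$; $\mathrm{mw}_r(G)$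 is the minimum. It is $d$-firm if for every $\{u,v\}\in R_m$, $\mathrm{dist}_G(u,v)\le d$ and $\mathrm{dist}_{\overline G}(u,v)\le d$. A $\mathcal P$-flip of $G$ complements the adjacency between all pairs of distinct vertices in $X\times Y$ for some chosen pairs $(X,Y)$ of parts (possibly $X=Y$). $\mathrm{dist}_{\mathcal P}(x,y)=\max\mathrm{dist}_{G'}(x,y)$ over all $\mathcal P$-flips $G'$; $\mathrm{Ball}^r_{\mathcal P}(v)=\{x:\mathrm{dist}_{\mathcal P}(x,v)\le r\}$. $\mathrm{pmw}_r(G)$ is the minimum over sequences $\mathcal P_1\preceq\dots\preceq\mathcal P_m$ of partitions of $V(G)$ with $\mathcal P_1$ into singletons and $\mathcal P_m=\{V(G)\}$ of $\max_{1\le i<m}\max_v|\mathrm{Ball}^r_{\mathcal P_{i+1}}(v)/\mathcal P_i|$; such a sequence witnesses $\mathrm{pmw}_r(G)\le k$ if this maximum is at most $k$. *)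

theory Defs
  imports
    Main
    "HOL-Library.Disjoint_Sets"
    "HOL-Library.Ramsey"
    "HOL-Library.Extended_Nat"
    "HOL-Library.Discrete_Functions"
    "HOL-Computational_Algebra.Polynomial"
begin

section \<open>Graphs\<close>

text \<open>
  A graph is a vertex set \<open>V\<close> with a set \<open>E\<close> of two-element subsets of \<open>V\<close>. The vertex set is
  nonempty: \<open>{V}\<close> is a partition of \<open>V\<close> only in that case, so the width parameters below are
  defined exactly for these graphs.
\<close>

definition fin_graph :: "'a set \<Rightarrow> 'a set set \<Rightarrow> bool" where
  "fin_graph V E \<longleftrightarrow> finite V \<and> V \<noteq> {} \<and> E \<subseteq> [V]\<^bsup>2\<^esup>"

definition edge_complement :: "'a set \<Rightarrow> 'a set set \<Rightarrow> 'a set set" where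
  "edge_complement V E = [V]\<^bsup>2\<^esup> - E"

definition nbhd :: "'a set \<Rightarrow> 'a set set \<Rightarrow> 'a \<Rightarrow> 'a set" where
  "nbhd V E v = {u \<in> V. {u, v} \<in> E}"

definition nbhd_complexity :: "'a set \<Rightarrow> 'a set set \<Rightarrow> nat \<Rightarrow> nat" where
  "nbhd_complexity V E m =
     Max {card ((\<lambda>v. nbhd V E v \<inter> A) ` V) | A. A \<subseteq> V \<and> card A \<le> m}"

text \<open>The \<open>n\<close>-th relational power of adjacency relates the ends of the walks of length \<open>n\<close>;
  the infimum over the empty set is \<open>\<infinity>\<close>.\<close>

definition gdist :: "'a set set \<Rightarrow> 'a \<Rightarrow> 'a \<Rightarrow> enat" where
  "gdist E u v = (INF n \<in> {n. (u, v) \<in> {(x, y). {x, y} \<in> E} ^^ n}. enat n)"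

definition gball :: "'a set \<Rightarrow> 'a set set \<Rightarrow> nat \<Rightarrow> 'a \<Rightarrow> 'a set" where
  "gball V R r v = {x \<in> V. gdist R v x \<le> enat r}"

section \<open>Merge-width\<close>

definition parts_meeting :: "'a set \<Rightarrow> 'a set set \<Rightarrow> 'a set set" where
  "parts_meeting X P = {Y \<in> P. Y \<inter> X \<noteq> {}}"

definition homogeneous_mod :: "'a set set \<Rightarrow> 'a set set \<Rightarrow> 'a set set \<Rightarrow> bool" where
  "homogeneous_mod E P R \<longleftrightarrow>
     (\<forall>X\<in>P. \<forall>Y\<in>P.
        (\<forall>x\<in>X. \<forall>y\<in>Y. x \<noteq> y \<and> {x, y} \<notin> R \<longrightarrow> {x, y} \<in> E) \<or>
        (\<forall>x\<in>X. \<forall>y\<in>Y. x \<noteq> y \<and> {x, y} \<notin> R \<longrightarrow> {x, y} \<notin> E))"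

text \<open>Sequences from the partition into singletons to the one-part partition, each partition
  coarser than or equal to the previous one.\<close>

definition partition_seq :: "'a set \<Rightarrow> 'a set set list \<Rightarrow> bool" where
  "partition_seq V Ps \<longleftrightarrow>
     Ps \<noteq> [] \<and> (\<forall>P \<in> set Ps. partition_on V P) \<and>
     hd Ps = (\<lambda>v. {v}) ` V \<and> last Ps = {V} \<and>
     (\<forall>t. Suc t < length Ps \<longrightarrow> refines V (Ps ! t) (Ps ! Suc t))"

type_synonym 'a mseq = "('a set set \<times> 'a set set) list"

definition merge_seq :: "'a set \<Rightarrow> 'a set set \<Rightarrow> 'a mseq \<Rightarrow> bool" where
  "merge_seq V E S \<longleftrightarrow>
     partition_seq V (map fst S) \<and>
     (\<forall>(P, R) \<in> set S. R \<subseteq> [V]\<^bsup>2\<^esup> \<and> homogeneous_mod E P R) \<and>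
     (\<forall>t. Suc t < length S \<longrightarrow> snd (S ! t) \<subseteq> snd (S ! Suc t))"

text \<open>On \<open>nat\<close>, the supremum of a finite set is its maximum, and \<open>0\<close> if the set is empty, which
  happens here only for sequences of length one.\<close>

definition merge_seq_width :: "nat \<Rightarrow> 'a set \<Rightarrow> 'a mseq \<Rightarrow> nat" where
  "merge_seq_width r V S =
     Sup {card (parts_meeting (gball V (snd (S ! Suc t)) r v) (fst (S ! t))) | t v.
            Suc t < length S \<and> v \<in> V}"

definition mw :: "nat \<Rightarrow> 'a set \<Rightarrow> 'a set set \<Rightarrow> nat" where
  "mw r V E = (LEAST w. \<exists>S. merge_seq V E S \<and> merge_seq_width r V S = w)"

definition firm :: "nat \<Rightarrow> 'a set \<Rightarrow> 'a set set \<Rightarrow> 'a mseq \<Rightarrow> bool" where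
  "firm d V E S \<longleftrightarrow>
     (\<forall>u v. {u, v} \<in> snd (last S) \<longrightarrow>
        gdist E u v \<le> enat d \<and> gdist (edge_complement V E) u v \<le> enat d)"

section \<open>Partition merge-width\<close>

text \<open>\<open>F\<close> is the set of chosen pairs of parts; choosing \<open>(X, Y)\<close>, \<open>(Y, X)\<close> or both amounts to
  the same.\<close>

definition flip :: "'a set set \<Rightarrow> ('a set \<times> 'a set) set \<Rightarrow> 'a set set" where
  "flip E F = sym_diff E {{x, y} | x y. x \<noteq> y \<and> (\<exists>(X, Y) \<in> F. x \<in> X \<and> y \<in> Y)}"

definition flip_dist :: "'a set set \<Rightarrow> 'a set set \<Rightarrow> 'a \<Rightarrow> 'a \<Rightarrow> enat" where
  "flip_dist E P x y = (SUP F \<in> Pow (P \<times> P). gdist (flip E F) x y)"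

definition flip_ball :: "'a set \<Rightarrow> 'a set set \<Rightarrow> 'a set set \<Rightarrow> nat \<Rightarrow> 'a \<Rightarrow> 'a set" where
  "flip_ball V E P r v = {x \<in> V. flip_dist E P x v \<le> enat r}"

definition partition_seq_width ::
    "nat \<Rightarrow> 'a set \<Rightarrow> 'a set set \<Rightarrow> 'a set set list \<Rightarrow> nat" where
  "partition_seq_width r V E Ps =
     Sup {card (parts_meeting (flip_ball V E (Ps ! Suc t) r v) (Ps ! t)) | t v.
            Suc t < length Ps \<and> v \<in> V}"

definition pmw :: "nat \<Rightarrow> 'a set \<Rightarrow> 'a set set \<Rightarrow> nat" where
  "pmw r V E = (LEAST w. \<exists>Ps. partition_seq V Ps \<and> partition_seq_width r V E Ps = w)"

section \<open>Random access machines\<close>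

text \<open>
  A structured random access machine under the uniform cost measure. A program uses finitely many
  registers and finitely many memory arrays, all holding natural numbers. The arithmetic is
  restricted to addition and truncated subtraction; without multiplication, the bit length of the
  largest stored number grows by at most one per step, and so running times are polynomially
  related to those of Turing machines.
\<close>

datatype ram =
    Lit nat nat            \<comment> \<open>\<open>x := c\<close>\<close>
  | Plus nat nat nat       \<comment> \<open>\<open>x := y + z\<close>\<close>
  | Minus nat nat nat      \<comment> \<open>\<open>x := y - z\<close>\<close>
  | Load nat nat nat       \<comment> \<open>\<open>x := a[y]\<close>, for a fixed array \<open>a\<close>\<close>
  | Store nat nat nat      \<comment> \<open>\<open>a[x] := y\<close>, for a fixed array \<open>a\<close>\<close>
  | Seq ram ram
  | Cond nat ram ram       \<comment> \<open>first branch iff register \<open>x\<close> is nonzero\<close>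
  | Loop nat ram           \<comment> \<open>repeat while register \<open>x\<close> is nonzero\<close>

type_synonym ram_state = "(nat \<Rightarrow> nat) \<times> (nat \<Rightarrow> nat \<Rightarrow> nat)"

text \<open>\<open>ram_exec c s t s'\<close>: started in state \<open>s\<close>, program \<open>c\<close> halts in state \<open>s'\<close> after \<open>t\<close> steps.\<close>

inductive ram_exec :: "ram \<Rightarrow> ram_state \<Rightarrow> nat \<Rightarrow> ram_state \<Rightarrow> bool" where
  Lit: "ram_exec (Lit x c) (\<rho>, \<mu>) 1 (\<rho>(x := c), \<mu>)"
| Plus: "ram_exec (Plus x y z) (\<rho>, \<mu>) 1 (\<rho>(x := \<rho> y + \<rho> z), \<mu>)"
| Minus: "ram_exec (Minus x y z) (\<rho>, \<mu>) 1 (\<rho>(x := \<rho> y - \<rho> z), \<mu>)"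
| Load: "ram_exec (Load x a y) (\<rho>, \<mu>) 1 (\<rho>(x := \<mu> a (\<rho> y)), \<mu>)"
| Store: "ram_exec (Store a x y) (\<rho>, \<mu>) 1 (\<rho>, \<mu>(a := (\<mu> a)(\<rho> x := \<rho> y)))"
| Seq: "ram_exec c s t s' \<Longrightarrow> ram_exec c' s' t' s'' \<Longrightarrow> ram_exec (Seq c c') s (t + t') s''"
| CondTrue: "fst s x \<noteq> 0 \<Longrightarrow> ram_exec c s t s' \<Longrightarrow> ram_exec (Cond x c c') s (Suc t) s'"
| CondFalse: "fst s x = 0 \<Longrightarrow> ram_exec c' s t s' \<Longrightarrow> ram_exec (Cond x c c') s (Suc t) s'"
| LoopFalse: "fst s x = 0 \<Longrightarrow> ram_exec (Loop x c) s 1 s"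
| LoopTrue: "fst s x \<noteq> 0 \<Longrightarrow> ram_exec c s t s' \<Longrightarrow> ram_exec (Loop x c) s' t' s'' \<Longrightarrow>
    ram_exec (Loop x c) s (Suc (t + t')) s''"

text \<open>The input is in array \<open>0\<close> and the output in array \<open>1\<close>, each preceded by its length;
  everything else is initially \<open>0\<close>.\<close>

definition ram_input :: "nat list \<Rightarrow> ram_state" where
  "ram_input xs =
     ((\<lambda>_. 0),
      (\<lambda>a i. if a = 0 \<and> i \<le> length xs then (length xs # xs) ! i else 0))"

definition ram_computes :: "ram \<Rightarrow> nat list \<Rightarrow> nat \<Rightarrow> nat list \<Rightarrow> bool" where
  "ram_computes c xs t ys \<longleftrightarrow>
     (\<exists>\<rho> \<mu>. ram_exec c (ram_input xs) t (\<rho>, \<mu>) \<and>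
        (\<forall>i \<le> length ys. \<mu> 1 i = (length ys # ys) ! i))"

text \<open>Number of binary digits of a list of numbers (the numbers \<open>0\<close> and \<open>1\<close> having one digit).\<close>

definition bit_size :: "nat list \<Rightarrow> nat" where
  "bit_size xs = (\<Sum>x\<leftarrow>xs. Suc (floor_log x))"

text \<open>Graphs on the vertex set \<open>{..<n}\<close> and pair sets are given by their adjacency matrices,
  partitions by the matrices of their equivalence relations, all listed row by row.\<close>

definition enc_matrix :: "nat \<Rightarrow> (nat \<Rightarrow> nat \<Rightarrow> bool) \<Rightarrow> nat list" where
  "enc_matrix n Q = [of_bool (Q i j). i \<leftarrow> [0..<n], j \<leftarrow> [0..<n]]"

definition enc_edges :: "nat \<Rightarrow> nat set set \<Rightarrow> nat list" where
  "enc_edges n E = enc_matrix n (\<lambda>i j. {i, j} \<in> E)"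

definition enc_partition :: "nat \<Rightarrow> nat set set \<Rightarrow> nat list" where
  "enc_partition n P = enc_matrix n (\<lambda>i j. \<exists>X\<in>P. i \<in> X \<and> j \<in> X)"

definition enc_instance :: "nat \<Rightarrow> nat set set \<Rightarrow> nat set set list \<Rightarrow> nat list" where
  "enc_instance n E Ps = n # length Ps # enc_edges n E @ concat (map (enc_partition n) Ps)"

definition enc_mseq :: "nat \<Rightarrow> nat mseq \<Rightarrow> nat list" where
  "enc_mseq n S =
     n # length S # concat (map (\<lambda>(P, R). enc_partition n P @ enc_edges n R) S)"

end

theory Submission
  imports Defs
begin

text \<open>
  Choose in every part of a partition \<open>P\<close> its least vertex as an anchor, refine \<open>P\<close> by adjacency to
  the anchors, and let \<open>R\<close> consist of the pairs \<open>u\<close>, \<open>v\<close> joined by a walk of length at most five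
  between their two parts both in \<open>G\<close> and in its complement. Such pairs are at distance at most six
  in every \<open>P\<close>-flip, and the refinement is homogeneous modulo \<open>R\<close>: given an edge and a non-edge
  between the same two refined parts, the walks through the two anchors put one of the pairs into
  \<open>R\<close>. For \<open>P = {V}\<close> no refinement is needed, since a graph or its complement has small diameter.
  An anchor that distinguishes two vertices of the same part is, in every flip, adjacent to one of
  them. So only the at most \<open>k\<close> anchors inside the flip ball of radius \<open>6 * r + 1\<close> split the parts
  meeting the ball of radius \<open>r\<close>, each into at most \<open>\<pi>(k)\<close> pieces. Anchors become fewer and walks
  more numerous as the partitions get coarser, so the construction is monotone.

  Membership in \<open>R\<close> and in the refined parts is expressed by fixed first-order formulas over \<open>G\<close>
  and \<open>P\<close>, which a random access machine evaluates in polynomial time by nested loops over the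
  vertices.
\<close>

section \<open>Distances and flips\<close>

text \<open>A nonempty set in \<open>enat\<close> attains its infimum, so a finite distance is the
  length of an actual walk.\<close>

lemma gdist_le_iff:
  "gdist H u v \<le> enat r \<longleftrightarrow> (\<exists>n\<le>r. (u, v) \<in> {(x, y). {x, y} \<in> H} ^^ n)"
proof
  assume le: "gdist H u v \<le> enat r"
  let ?N = "{n. (u, v) \<in> {(x, y). {x, y} \<in> H} ^^ n}"
  have "?N \<noteq> {}"
  proof
    assume "?N = {}"
    then have "gdist H u v = \<infinity>" unfolding gdist_def by (simp add: top_enat_def)
    then show False using le by simp
  qed
  then obtain m where "m \<in> ?N" by blast
  then have "Inf (enat ` ?N) \<in> enat ` ?N" by (intro wellorder_InfI[of "enat m"]) auto
  then show "\<exists>n\<le>r. (u, v) \<in> {(x, y). {x, y} \<in> H} ^^ n"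
    using le unfolding gdist_def by auto
next
  assume "\<exists>n\<le>r. (u, v) \<in> {(x, y). {x, y} \<in> H} ^^ n"
  then obtain n where n: "n \<le> r" "(u, v) \<in> {(x, y). {x, y} \<in> H} ^^ n" by blast
  then have "gdist H u v \<le> enat n" unfolding gdist_def by (intro INF_lower) auto
  then show "gdist H u v \<le> enat r" using n(1) order_trans by fastforce
qed

lemma gdist_refl: "gdist H u u \<le> enat r"
  unfolding gdist_le_iff by (intro exI[of _ 0]) auto

lemma gdist_edge: "{u, v} \<in> H \<Longrightarrow> gdist H u v \<le> enat 1"
  unfolding gdist_le_iff by (intro exI[of _ 1]) auto

lemma gdist_trans:
  assumes "gdist H u v \<le> enat a" "gdist H v w \<le> enat b"
  shows "gdist H u w \<le> enat (a + b)"
proof -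
  obtain m n where "m \<le> a" "(u, v) \<in> {(x, y). {x, y} \<in> H} ^^ m"
    "n \<le> b" "(v, w) \<in> {(x, y). {x, y} \<in> H} ^^ n"
    using assms unfolding gdist_le_iff by blast
  then show ?thesis unfolding gdist_le_iff
    by (intro exI[of _ "m + n"]) (auto simp: relpow_add)
qed

lemma gdist_mono: "gdist H u v \<le> enat a \<Longrightarrow> a \<le> b \<Longrightarrow> gdist H u v \<le> enat b"
  using order_trans by fastforce

lemma gdist_sym_le: "gdist H u v \<le> enat r \<Longrightarrow> gdist H v u \<le> enat r"
proof -
  assume "gdist H u v \<le> enat r"
  then obtain n where n: "n \<le> r" "(u, v) \<in> {(x, y). {x, y} \<in> H} ^^ n"
    unfolding gdist_le_iff by blast
  have *: "(u, v) \<in> {(x, y). {x, y} \<in> H} ^^ n \<Longrightarrow> gdist H v u \<le> enat n"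
  proof (induction n arbitrary: v)
    case 0
    then show ?case by (simp add: gdist_refl)
  next
    case (Suc n)
    then obtain w where "gdist H w u \<le> enat n" "{v, w} \<in> H" by (auto simp: insert_commute)
    then show ?case using gdist_trans[OF gdist_edge] by fastforce
  qed
  show ?thesis by (rule gdist_mono[OF *[OF n(2)] n(1)])
qed

lemma flip_dist_le_iff:
  "flip_dist E P x y \<le> enat r \<longleftrightarrow> (\<forall>F\<subseteq>P \<times> P. gdist (flip E F) x y \<le> enat r)"
  unfolding flip_dist_def by (auto simp: SUP_le_iff)

section \<open>Partitions as equivalence relations\<close>

definition same :: "'a set set \<Rightarrow> 'a \<Rightarrow> 'a \<Rightarrow> bool" where
  "same P x y \<longleftrightarrow> (\<exists>X\<in>P. x \<in> X \<and> y \<in> X)"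

lemma same_sym: "same P x y \<Longrightarrow> same P y x"
  unfolding same_def by blast

lemma same_refl: "partition_on V P \<Longrightarrow> x \<in> V \<Longrightarrow> same P x x"
  unfolding same_def partition_on_def by blast

lemma part_unique:
  "partition_on V P \<Longrightarrow> X \<in> P \<Longrightarrow> Y \<in> P \<Longrightarrow> x \<in> X \<Longrightarrow> x \<in> Y \<Longrightarrow> X = Y"
  unfolding partition_on_def disjoint_def by blast

lemma same_trans: "partition_on V P \<Longrightarrow> same P x y \<Longrightarrow> same P y z \<Longrightarrow> same P x z"
  unfolding same_def using part_unique by metis

lemma same_in: "partition_on V P \<Longrightarrow> same P x y \<Longrightarrow> x \<in> V \<and> y \<in> V"
  unfolding same_def partition_on_def by blast

lemma same_in_part:
  "partition_on V P \<Longrightarrow> same P x y \<Longrightarrow> X \<in> P \<Longrightarrow> x \<in> X \<longleftrightarrow> y \<in> X"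
  unfolding same_def using part_unique by metis

lemma refines_same: "refines V P Q \<Longrightarrow> same P x y \<Longrightarrow> same Q x y"
  unfolding same_def refines_def by (meson subsetD)

text \<open>Turns \<open>P \<noteq> {V}\<close> into a pair of inequivalent vertices, the form in
  which \<open>anchors\<close> excludes the trivial partition.\<close>

lemma all_same_imp_trivial:
  assumes "partition_on V P" "V \<noteq> {}" "\<And>x y. x \<in> V \<Longrightarrow> y \<in> V \<Longrightarrow> same P x y"
  shows "P = {V}"
proof -
  have "X = V" if X: "X \<in> P" for X
  proof -
    obtain x where "x \<in> X" using X assms(1) unfolding partition_on_def by (metis all_not_in_conv)
    then show ?thesis using assms X same_in_part[OF assms(1)] unfolding partition_on_def by blast
  qed
  then show ?thesis using assms unfolding partition_on_def by blast
qed

section \<open>The action of a flip on a single pair\<close>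

lemma mem_flip_iff:
  assumes "x \<noteq> y"
  shows "{x, y} \<in> flip E F \<longleftrightarrow>
     ({x, y} \<in> E) \<noteq> (\<exists>(X, Y) \<in> F. x \<in> X \<and> y \<in> Y \<or> y \<in> X \<and> x \<in> Y)"
    (is "_ \<longleftrightarrow> _ \<noteq> ?T")
proof -
  have "{x, y} \<in> {{x, y} | x y. x \<noteq> y \<and> (\<exists>(X, Y) \<in> F. x \<in> X \<and> y \<in> Y)} \<longleftrightarrow> ?T"
  proof
    assume "?T"
    then obtain X Y where XY: "(X, Y) \<in> F" "x \<in> X \<and> y \<in> Y \<or> y \<in> X \<and> x \<in> Y" by blast
    from XY(2) show "{x, y} \<in> {{x, y} | x y. x \<noteq> y \<and> (\<exists>(X, Y) \<in> F. x \<in> X \<and> y \<in> Y)}"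
    proof
      assume "x \<in> X \<and> y \<in> Y"
      then have "\<exists>p q. {x, y} = {p, q} \<and> p \<noteq> q \<and> (\<exists>(X, Y) \<in> F. p \<in> X \<and> q \<in> Y)"
        using XY(1) assms by (intro exI[of _ x] exI[of _ y]) auto
      then show ?thesis by simp
    next
      assume "y \<in> X \<and> x \<in> Y"
      then have "\<exists>p q. {x, y} = {p, q} \<and> p \<noteq> q \<and> (\<exists>(X, Y) \<in> F. p \<in> X \<and> q \<in> Y)"
        using XY(1) assms by (intro exI[of _ y] exI[of _ x]) auto
      then show ?thesis by simp
    qed
  next
    assume "{x, y} \<in> {{x, y} | x y. x \<noteq> y \<and> (\<exists>(X, Y) \<in> F. x \<in> X \<and> y \<in> Y)}"
    then obtain p q X Y where "{x, y} = {p, q}" "(X, Y) \<in> F" "p \<in> X" "q \<in> Y" by auto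
    then show ?T unfolding doubleton_eq_iff by blast
  qed
  then show ?thesis unfolding flip_def Un_iff Diff_iff by argo
qed

text \<open>Whether a pair is complemented depends only on the parts of its two ends. The ends must
  be distinct, since a flip never touches the diagonal.\<close>

lemma flip_uniform:
  assumes "partition_on V P" "F \<subseteq> P \<times> P" "same P x x'" "same P y y'" "x \<noteq> y" "x' \<noteq> y'"
  shows "({x, y} \<in> flip E F \<longleftrightarrow> {x, y} \<in> E) \<longleftrightarrow> ({x', y'} \<in> flip E F \<longleftrightarrow> {x', y'} \<in> E)"
proof -
  have "(\<exists>(X, Y) \<in> F. x \<in> X \<and> y \<in> Y \<or> y \<in> X \<and> x \<in> Y) \<longleftrightarrow>
        (\<exists>(X, Y) \<in> F. x' \<in> X \<and> y' \<in> Y \<or> y' \<in> X \<and> x' \<in> Y)"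
  proof (intro bex_cong refl, clarify)
    fix X Y assume "(X, Y) \<in> F"
    then have "X \<in> P" "Y \<in> P" using assms(2) by auto
    then show "(x \<in> X \<and> y \<in> Y \<or> y \<in> X \<and> x \<in> Y) = (x' \<in> X \<and> y' \<in> Y \<or> y' \<in> X \<and> x' \<in> Y)"
      using same_in_part[OF assms(1) assms(3)] same_in_part[OF assms(1) assms(4)] by simp
  qed
  then show ?thesis unfolding mem_flip_iff[OF assms(5)] mem_flip_iff[OF assms(6)] by argo
qed

section \<open>Pairs that are close in every flip\<close>

text \<open>A flip either keeps or complements all pairs between the parts of \<open>u\<close> and \<open>v\<close> at once, so it
  preserves the walks of \<open>linked\<close> in \<open>E\<close> or those in the complement. Length five is what the case
  distinction in \<open>not_mixed\<close> needs.\<close>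

definition step :: "'a set set \<Rightarrow> 'a set set \<Rightarrow> 'a \<Rightarrow> 'a \<Rightarrow> 'a \<Rightarrow> 'a \<Rightarrow> bool" where
  "step H P u v x y \<longleftrightarrow> x = y \<or>
     {x, y} \<in> H \<and> (same P u x \<and> same P v y \<or> same P v x \<and> same P u y)"

definition linked :: "'a set \<Rightarrow> 'a set set \<Rightarrow> 'a set set \<Rightarrow> 'a \<Rightarrow> 'a \<Rightarrow> bool" where
  "linked V H P u v \<longleftrightarrow> (\<exists>a\<in>V. \<exists>b\<in>V. \<exists>c\<in>V. \<exists>d\<in>V.
     step H P u v u a \<and> step H P u v a b \<and> step H P u v b c \<and> step H P u v c d \<and>
     step H P u v d v)"

definition close_pairs :: "'a set \<Rightarrow> 'a set set \<Rightarrow> 'a set set \<Rightarrow> 'a set set" where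
  "close_pairs V E P = {{u, v} | u v. u \<in> V \<and> v \<in> V \<and> u \<noteq> v \<and>
     linked V E P u v \<and> linked V (edge_complement V E) P u v}"

lemma step_sym: "step H P u v x y \<Longrightarrow> step H P v u y x"
  unfolding step_def by (auto simp: insert_commute)

lemma linked_sym: "linked V H P u v \<Longrightarrow> linked V H P v u"
proof -
  assume "linked V H P u v"
  then obtain a b c d where "a \<in> V" "b \<in> V" "c \<in> V" "d \<in> V" "step H P u v u a"
    "step H P u v a b" "step H P u v b c" "step H P u v c d" "step H P u v d v"
    unfolding linked_def by blast
  then show ?thesis unfolding linked_def
    by (intro bexI[of _ d] bexI[of _ c] bexI[of _ b] bexI[of _ a] conjI) (auto intro: step_sym)
qed

text \<open>As \<open>close_pairs\<close> collects unordered pairs, \<open>{u, v}\<close> may have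
  entered it as \<open>{v, u}\<close>; symmetry of \<open>linked\<close> makes this
  harmless.\<close>

lemma mem_close_pairs_iff:
  "{u, v} \<in> close_pairs V E P \<longleftrightarrow> u \<in> V \<and> v \<in> V \<and> u \<noteq> v \<and>
     linked V E P u v \<and> linked V (edge_complement V E) P u v"
proof
  assume "{u, v} \<in> close_pairs V E P"
  then obtain x y where xy: "{u, v} = {x, y}" "x \<in> V" "y \<in> V" "x \<noteq> y" "linked V E P x y"
      "linked V (edge_complement V E) P x y"
    unfolding close_pairs_def mem_Collect_eq by blast
  from xy(1) consider "u = x" "v = y" | "u = y" "v = x" unfolding doubleton_eq_iff by blast
  then show "u \<in> V \<and> v \<in> V \<and> u \<noteq> v \<and>
     linked V E P u v \<and> linked V (edge_complement V E) P u v"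
    by cases (use xy in \<open>auto intro: linked_sym\<close>)
qed (unfold close_pairs_def, blast)

lemma close_pairs_subset: "close_pairs V E P \<subseteq> [V]\<^bsup>2\<^esup>"
  unfolding close_pairs_def nsets_def by (auto simp: numeral_2_eq_2)

lemma mem_edge_complement_iff:
  "{x, y} \<in> edge_complement V E \<longleftrightarrow> x \<in> V \<and> y \<in> V \<and> x \<noteq> y \<and> {x, y} \<notin> E"
  unfolding edge_complement_def nsets_def by (auto simp: card_2_iff doubleton_eq_iff)

lemma step_mono: "refines V P Q \<Longrightarrow> step H P u v x y \<Longrightarrow> step H Q u v x y"
  unfolding step_def using refines_same by fast

lemma linked_mono: "refines V P Q \<Longrightarrow> linked V H P u v \<Longrightarrow> linked V H Q u v"
  unfolding linked_def by (elim bexE conjE, intro bexI conjI) (erule (1) step_mono | assumption)+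

text \<open>Larger parts admit more steps. This makes the pair sets of the merge sequence
  increase.\<close>

lemma close_pairs_mono: "refines V P Q \<Longrightarrow> close_pairs V E P \<subseteq> close_pairs V E Q"
  unfolding close_pairs_def
  by (intro subsetI, unfold mem_Collect_eq, elim exE conjE, intro exI conjI) (erule (1) linked_mono | assumption)+

text \<open>The graph \<open>K\<close> may differ from \<open>H\<close>: it is a flip in
  \<open>close_pairs_flip\<close>, and \<open>H\<close> itself for firmness.\<close>

lemma linked_gdist:
  assumes "linked V H P u v" "\<And>x y. step H P u v x y \<Longrightarrow> x = y \<or> {x, y} \<in> K"
  shows "gdist K u v \<le> enat 6"
proof -
  have step: "gdist K x y \<le> enat 1" if "step H P u v x y" for x y
    using assms(2)[OF that] gdist_refl gdist_edge by metis
  obtain a b c d where "step H P u v u a" "step H P u v a b" "step H P u v b c" "step H P u v c d"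
     "step H P u v d v"
    using assms(1) unfolding linked_def by blast
  \<comment> \<open>Five steps of length at most one; the bound \<open>5\<close> is then relaxed to
    \<open>6\<close>.\<close>
  then have "gdist K u v \<le> enat (1 + 1 + 1 + 1 + 1)"
    by (intro gdist_trans[OF gdist_trans[OF gdist_trans[OF gdist_trans]]] step)
  then show ?thesis by (rule gdist_mono) simp
qed

lemma close_pairs_flip:
  assumes "fin_graph V E" "partition_on V P" "{u, v} \<in> close_pairs V E P" "F \<subseteq> P \<times> P"
  shows "gdist (flip E F) u v \<le> enat 6"
proof -
  have uv: "u \<in> V" "v \<in> V" "u \<noteq> v" "linked V E P u v" "linked V (edge_complement V E) P u v"
    using assms(3) unfolding mem_close_pairs_iff by auto
  \<comment> \<open>The pair \<open>{u, v}\<close> serves as the test case: every pair used by a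
    proper step runs between the same two parts, so the flip treats it as it treats
    \<open>{u, v}\<close>.\<close>
  have unif: "({x, y} \<in> flip E F \<longleftrightarrow> {x, y} \<in> E) \<longleftrightarrow> ({u, v} \<in> flip E F \<longleftrightarrow> {u, v} \<in> E)"
    if "x \<noteq> y" "same P u x \<and> same P v y \<or> same P v x \<and> same P u y" for x y
    using that(2)
  proof
    assume "same P u x \<and> same P v y"
    then show ?thesis using flip_uniform[OF assms(2,4), of u x v y E] that(1) uv(3) by simp
  next
    assume "same P v x \<and> same P u y"
    then show ?thesis
      using flip_uniform[OF assms(2,4), of u y v x E] that(1) uv(3) by (simp add: insert_commute)
  qed
  show ?thesis
  proof (cases "{u, v} \<in> flip E F \<longleftrightarrow> {u, v} \<in> E")
    case True
    show ?thesis
    proof (rule linked_gdist[OF uv(4)])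
      fix x y assume "step E P u v x y"
      then show "x = y \<or> {x, y} \<in> flip E F" unfolding step_def using unif[of x y] True by argo
    qed
  next
    case False
    show ?thesis
    proof (rule linked_gdist[OF uv(5)])
      fix x y assume "step (edge_complement V E) P u v x y"
      then show "x = y \<or> {x, y} \<in> flip E F"
        unfolding step_def mem_edge_complement_iff using unif[of x y] False by argo
    qed
  qed
qed

text \<open>In any fixed flip, each pair of \<open>close_pairs\<close> along a walk costs at most
  six edges, whence the factor six in the radius.\<close>

lemma close_ball_subset_flip_ball:
  assumes "fin_graph V E" "partition_on V P"
  shows "gball V (close_pairs V E P) r v \<subseteq> flip_ball V E P (6 * r) v"
proof
  fix x assume "x \<in> gball V (close_pairs V E P) r v"
  then have x: "x \<in> V" "gdist (close_pairs V E P) v x \<le> enat r" unfolding gball_def by auto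
  then obtain n where n: "n \<le> r" "(v, x) \<in> {(x, y). {x, y} \<in> close_pairs V E P} ^^ n"
    unfolding gdist_le_iff by blast
  have "gdist (flip E F) v x \<le> enat (6 * n)" if F: "F \<subseteq> P \<times> P" for F
    using n(2)
  proof (induction n arbitrary: x)
    case 0
    then show ?case by (simp add: gdist_refl)
  next
    case (Suc n)
    then obtain w where w: "(v, w) \<in> {(x, y). {x, y} \<in> close_pairs V E P} ^^ n"
      "{w, x} \<in> close_pairs V E P" by auto
    from gdist_trans[OF Suc.IH[OF w(1)] close_pairs_flip[OF assms w(2) F]]
    show ?case by (simp add: add.commute)
  qed
  \<comment> \<open>\<open>gball\<close> measures distance from the centre and
    \<open>flip_ball\<close> towards it, so the walk is reversed.\<close>
  then have "gdist (flip E F) x v \<le> enat (6 * r)" if F: "F \<subseteq> P \<times> P" for F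
    using n(1) F by (meson gdist_sym_le gdist_mono mult_le_mono2)
  then show "x \<in> flip_ball V E P (6 * r) v"
    unfolding flip_ball_def flip_dist_le_iff using x(1) by blast
qed

section \<open>Refinement by anchors\<close>

text \<open>The trivial partition has no anchors, so that its refinement below is trivial again.\<close>

definition anchors :: "('a \<Rightarrow> nat) \<Rightarrow> 'a set \<Rightarrow> 'a set set \<Rightarrow> 'a set" where
  "anchors f V P = {a \<in> V. (\<exists>b\<in>V. \<exists>c\<in>V. \<not> same P b c) \<and>
     (\<forall>b\<in>V. same P a b \<longrightarrow> \<not> f b < f a)}"

text \<open>The anchors of all parts are compared, not only the one in the part of \<open>x\<close>
  and \<open>y\<close>. The vertices need no order of their own: \<open>f\<close> numbers them, and
  it becomes \<open>id\<close> for the machine.\<close>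

definition agree :: "('a \<Rightarrow> nat) \<Rightarrow> 'a set \<Rightarrow> 'a set set \<Rightarrow> 'a set set \<Rightarrow> 'a \<Rightarrow> 'a \<Rightarrow> bool" where
  "agree f V E P x y \<longleftrightarrow>
     same P x y \<and> (\<forall>a\<in>anchors f V P. {a, x} \<in> E \<longleftrightarrow> {a, y} \<in> E)"

definition anchor_refinement ::
    "('a \<Rightarrow> nat) \<Rightarrow> 'a set \<Rightarrow> 'a set set \<Rightarrow> 'a set set \<Rightarrow> 'a set set" where
  "anchor_refinement f V E P = (\<lambda>x. {y \<in> V. agree f V E P x y}) ` V"

lemma agree_sym: "agree f V E P x y \<Longrightarrow> agree f V E P y x"
  unfolding agree_def using same_sym by metis

lemma agree_trans:
  "partition_on V P \<Longrightarrow> agree f V E P x y \<Longrightarrow> agree f V E P y z \<Longrightarrow> agree f V E P x z"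
  unfolding agree_def using same_trans by metis

lemma agree_refl: "partition_on V P \<Longrightarrow> x \<in> V \<Longrightarrow> agree f V E P x x"
  unfolding agree_def using same_refl by metis

lemma partition_on_anchor_refinement:
  assumes "partition_on V P"
  shows "partition_on V (anchor_refinement f V E P)"
proof (rule partition_onI)
  let ?C = "\<lambda>x. {y \<in> V. agree f V E P x y}"
  have C: "?C x = ?C y" if "agree f V E P x y" for x y
    using agree_trans[OF assms that] agree_trans[OF assms agree_sym[OF that]] by blast
  have mem: "x \<in> ?C x" if "x \<in> V" for x using agree_refl[OF assms that] that by simp
  show "\<Union> (anchor_refinement f V E P) = V"
    unfolding anchor_refinement_def using mem by blast
  show "{} \<notin> anchor_refinement f V E P"
    using mem unfolding anchor_refinement_def by blast
  show "disjnt p q"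
    if pq: "p \<in> anchor_refinement f V E P" "q \<in> anchor_refinement f V E P" "p \<noteq> q" for p q
  proof (rule ccontr)
    assume "\<not> disjnt p q"
    then obtain z where z: "z \<in> p" "z \<in> q" unfolding disjnt_def by blast
    obtain x y where "p = ?C x" "q = ?C y" using pq unfolding anchor_refinement_def by blast
    then have "p = ?C z" "q = ?C z" using z C by auto
    then show False using pq(3) by simp
  qed
qed

lemma same_anchor_refinement:
  assumes "partition_on V P"
  shows "same (anchor_refinement f V E P) x y \<longleftrightarrow> agree f V E P x y"
proof
  assume "same (anchor_refinement f V E P) x y"
  then obtain z where "agree f V E P z x" "agree f V E P z y"
    unfolding same_def anchor_refinement_def by blast
  then show "agree f V E P x y" using agree_trans[OF assms agree_sym] by blast
next
  assume xy: "agree f V E P x y"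
  then have "x \<in> V" "y \<in> V" using same_in[OF assms] unfolding agree_def by blast+
  then show "same (anchor_refinement f V E P) x y"
    unfolding same_def anchor_refinement_def using xy agree_refl[OF assms] by blast
qed

lemma refines_if_same:
  assumes "partition_on V P" "partition_on V Q" "\<And>x y. same P x y \<Longrightarrow> same Q x y"
  shows "refines V P Q"
  unfolding refines_def
proof (intro conjI assms ballI)
  fix X assume X: "X \<in> P"
  then obtain x where x: "x \<in> X" using assms(1) unfolding partition_on_def by (metis all_not_in_conv)
  then have "same Q x x" using X assms(3) unfolding same_def by blast
  then obtain Y where Y: "Y \<in> Q" "x \<in> Y" unfolding same_def by blast
  have "X \<subseteq> Y"
  proof
    fix y assume "y \<in> X"
    then have "same Q x y" using X x assms(3) unfolding same_def by blast
    then show "y \<in> Y" using same_in_part[OF assms(2) _ Y(1)] Y(2) by blast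
  qed
  then show "\<exists>Y\<in>Q. X \<subseteq> Y" using Y by blast
qed

text \<open>The first vertex of a coarse part is also first in the finer part containing it, and
  vertices separated by \<open>Q\<close> are separated by \<open>P\<close>.\<close>

lemma anchors_antimono:
  "refines V P Q \<Longrightarrow> anchors f V Q \<subseteq> anchors f V P"
  unfolding anchors_def using refines_same by (smt (verit) Collect_mono)

lemma anchor_refinement_mono:
  assumes "refines V P Q"
  shows "refines V (anchor_refinement f V E P) (anchor_refinement f V E Q)"
proof -
  have PQ: "partition_on V P" "partition_on V Q" using assms unfolding refines_def by auto
  have "agree f V E Q x y" if "agree f V E P x y" for x y
    using that anchors_antimono[OF assms, of f] refines_same[OF assms] unfolding agree_def by blast
  then show ?thesis
    by (intro refines_if_same partition_on_anchor_refinement PQ)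
      (simp add: same_anchor_refinement PQ)
qed

text \<open>Singletons cannot be split. Together with the trivial partition, which has no anchors,
  this fixes both ends of the sequence.\<close>

lemma anchor_refinement_singletons:
  "anchor_refinement f V E ((\<lambda>v. {v}) ` V) = (\<lambda>v. {v}) ` V"
  unfolding anchor_refinement_def agree_def same_def by (intro image_cong) auto

lemma anchor_refinement_trivial:
  assumes "V \<noteq> {}"
  shows "anchor_refinement f V E {V} = {V}"
  using assms unfolding anchor_refinement_def agree_def anchors_def same_def by auto

lemma ex_anchor:
  assumes "partition_on V P" "x \<in> V" "P \<noteq> {V}"
  obtains a where "a \<in> anchors f V P" "same P x a" "a \<in> V"
proof -
  have "\<exists>b\<in>V. \<exists>c\<in>V. \<not> same P b c"
    using all_same_imp_trivial[OF assms(1)] assms(2,3) by blast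
  \<comment> \<open>A vertex with the least value of \<open>f\<close> in the part of
    \<open>x\<close>.\<close>
  moreover obtain a where "same P x a" "\<And>b. same P x b \<Longrightarrow> \<not> f b < f a"
    using exists_least_iff[of "\<lambda>n. \<exists>b. same P x b \<and> f b = n"] same_refl[OF assms(1,2)] by blast
  ultimately have "a \<in> anchors f V P" "same P x a" "a \<in> V"
    unfolding anchors_def using same_in[OF assms(1)] same_trans[OF assms(1)] by blast+
  then show thesis using that by blast
qed

section \<open>Homogeneity of the refinement\<close>

lemma linkedI:
  assumes "u \<in> V" "v \<in> V" "partition_on V P"
    "step H P u v u a" "step H P u v a b" "step H P u v b c" "step H P u v c d" "step H P u v d v"
  shows "linked V H P u v"
proof -
  have "y \<in> V" if "step H P u v x y" "x \<in> V" for x y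
    using that same_in[OF assms(3)] unfolding step_def by blast
  then have "a \<in> V" "b \<in> V" "c \<in> V" "d \<in> V" using assms by blast+
  then show ?thesis unfolding linked_def using assms(4-8)
    by (intro bexI[of _ a] bexI[of _ b] bexI[of _ c] bexI[of _ d] conjI)
qed

text \<open>The pair \<open>{x, y}\<close> is itself a walk in the graph and \<open>{x', y'}\<close>
  one in the complement, so for one of them a walk of the other kind is wanted. If both
  \<open>{b, x}\<close> and \<open>{a, y}\<close> are edges, x', b, x, y, a, y' is a walk in the
  graph; if neither is, x, b, x', y', a, y is one in the complement. If only \<open>{b, x}\<close>
  is an edge, the pair \<open>{x, y'}\<close> completes either x', b, x, y' in the graph or x, y',
  a, y in the complement; if only \<open>{a, y}\<close> is, the pair \<open>{x', y}\<close> plays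
  this part.\<close>

lemma not_mixed:
  assumes P: "partition_on V P" and E: "fin_graph V E"
    and x: "same P x x'" and y: "same P y y'"
    and b: "same P y b" "{b, x} \<in> E \<longleftrightarrow> {b, x'} \<in> E"
    and a: "same P x a" "{a, y} \<in> E \<longleftrightarrow> {a, y'} \<in> E"
    and e: "{x, y} \<in> E" "x' \<noteq> y'" "{x', y'} \<notin> E"
  shows "{x, y} \<in> close_pairs V E P \<or> {x', y'} \<in> close_pairs V E P"
proof -
  let ?C = "edge_complement V E"
  have xy: "x \<noteq> y"
    using E e(1) unfolding fin_graph_def nsets_def by (auto simp: card_2_iff)
  have V: "x \<in> V" "y \<in> V" "x' \<in> V" "y' \<in> V" "a \<in> V" "b \<in> V"
    using x y a b same_in[OF P] by blast+
  have s: "same P x x" "same P y y" "same P x' x" "same P y' y" "same P x' x'" "same P y' y'"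
      "same P x' a" "same P y' b"
    using V x y a b P same_refl same_sym same_trans by metis+
  note st = x y a b s
  \<comment> \<open>Equal vertices are covered too: \<open>b\<close> may coincide with
    \<open>x\<close> or \<open>x'\<close> when the two parts are the same, and the step then stands
    still.\<close>
  have EC: "{p, q} \<in> E \<or> step ?C P u v p q"
    if "p \<in> V" "q \<in> V" "same P u p \<and> same P v q \<or> same P v p \<and> same P u q" for p q u v
    using that unfolding step_def by (auto simp: mem_edge_complement_iff)
  have l1: "linked V E P x y"
    by (rule linkedI[OF V(1,2) P, of _ x x x x]) (use e st in \<open>auto simp: step_def\<close>)
  have l2: "linked V ?C P x' y'"
    by (rule linkedI[OF V(3,4) P, of _ x' x' x' x'])
      (use e V st in \<open>auto simp: step_def mem_edge_complement_iff\<close>)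
  have "linked V ?C P x y \<or> linked V E P x' y'"
  proof (cases "{b, x} \<in> E"; cases "{a, y} \<in> E")
    assume "{b, x} \<in> E" "{a, y} \<in> E"
    then have "linked V E P x' y'"
      by (intro linkedI[OF V(3,4) P, of _ b x y a])
        (use e st in \<open>auto simp: step_def insert_commute\<close>)
    then show ?thesis by simp
  next
    assume n: "{b, x} \<notin> E" "{a, y} \<notin> E"
    have "linked V ?C P x y"
      by (rule linkedI[OF V(1,2) P, of _ b x' y' a])
        (use EC[of x b x y] EC[of b x' x y] EC[of x' y' x y] EC[of y' a x y] EC[of a y x y] e st n V
          in \<open>auto simp: insert_commute\<close>)
    then show ?thesis by simp
  next
    assume n: "{b, x} \<in> E" "{a, y} \<notin> E"
    show ?thesis
    proof (cases "{x, y'} \<in> E")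
      case True
      then have "linked V E P x' y'"
        by (intro linkedI[OF V(3,4) P, of _ b x y' y'])
          (use e st n in \<open>auto simp: step_def insert_commute\<close>)
      then show ?thesis by simp
    next
      case False
      have "linked V ?C P x y"
        by (rule linkedI[OF V(1,2) P, of _ y' a y y])
        (use EC[of x y' x y] EC[of y' a x y] EC[of a y x y] e st n V False
          in \<open>auto simp: insert_commute step_def\<close>)
      then show ?thesis by simp
    qed
  next
    assume n: "{b, x} \<notin> E" "{a, y} \<in> E"
    show ?thesis
    proof (cases "{x', y} \<in> E")
      case True
      then have "linked V E P x' y'"
        by (intro linkedI[OF V(3,4) P, of _ y a y' y'])
          (use e st n in \<open>auto simp: step_def insert_commute\<close>)
      then show ?thesis by simp
    next
      case False
      have "linked V ?C P x y"
        by (rule linkedI[OF V(1,2) P, of _ b x' y y])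
        (use EC[of x b x y] EC[of b x' x y] EC[of x' y x y] e st n V False
          in \<open>auto simp: insert_commute step_def\<close>)
      then show ?thesis by simp
    qed
  qed
  then show ?thesis using l1 l2 V xy e(2) unfolding mem_close_pairs_iff by blast
qed

text \<open>Steps may now use all pairs of vertices. If some further vertex is adjacent to neither
  end of the edge \<open>{x, y}\<close>, it joins the two ends in the complement. Otherwise every
  vertex is on this edge or adjacent to one of its ends, so x' and y' are joined through it by at
  most three edges.\<close>

lemma homogeneous_trivial:
  assumes E: "fin_graph V E"
  shows "homogeneous_mod E {V} (close_pairs V E {V})"
proof -
  let ?R = "close_pairs V E {V}" and ?C = "edge_complement V E"
  have P: "partition_on V {V}" using E unfolding fin_graph_def partition_on_def by (auto simp: disjoint_def)
  have st: "step H {V} u v p q"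
    if "p \<in> V" "q \<in> V" "u \<in> V" "v \<in> V" "p = q \<or> {p, q} \<in> H" for H u v p q
    using that unfolding step_def same_def by blast
  have "{x, y} \<in> ?R \<or> {x', y'} \<in> ?R"
    if V: "x \<in> V" "y \<in> V" "x' \<in> V" "y' \<in> V" and e: "x \<noteq> y" "{x, y} \<in> E" "x' \<noteq> y'" "{x', y'} \<notin> E"
    for x y x' y'
  proof -
    have l1: "linked V E {V} x y"
      by (rule linkedI[OF V(1,2) P, of _ x x x x]) (use e V in \<open>auto intro!: st\<close>)
    have l2: "linked V ?C {V} x' y'"
      by (rule linkedI[OF V(3,4) P, of _ x' x' x' x'])
        (use e V in \<open>auto intro!: st simp: mem_edge_complement_iff\<close>)
    have "linked V ?C {V} x y \<or> linked V E {V} x' y'"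
    proof (cases "\<exists>z\<in>V. z \<noteq> x \<and> z \<noteq> y \<and> {x, z} \<notin> E \<and> {z, y} \<notin> E")
      case True
      then obtain z where "z \<in> V" "z \<noteq> x" "z \<noteq> y" "{x, z} \<notin> E" "{z, y} \<notin> E" by blast
      then have "linked V ?C {V} x y"
        by (intro linkedI[OF V(1,2) P, of _ z y y y])
          (use V in \<open>auto intro!: st simp: mem_edge_complement_iff\<close>)
      then show ?thesis by simp
    next
      case False
      then have *: "\<exists>w\<in>{x, y}. z = w \<or> {z, w} \<in> E" if "z \<in> V" for z
        using that by (auto simp: insert_commute)
      obtain p where p: "p \<in> {x, y}" "x' = p \<or> {x', p} \<in> E" using *[OF V(3)] by blast
      obtain q where q: "q \<in> {x, y}" "y' = q \<or> {y', q} \<in> E" using *[OF V(4)] by blast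
      have "linked V E {V} x' y'"
        by (rule linkedI[OF V(3,4) P, of _ p q y' y'])
          (use p q e V in \<open>auto intro!: st simp: insert_commute\<close>)
      then show ?thesis by simp
    qed
    then show ?thesis using l1 l2 V e unfolding mem_close_pairs_iff by blast
  qed
  then show ?thesis unfolding homogeneous_mod_def by fast
qed

lemma homogeneous_anchor_refinement:
  assumes E: "fin_graph V E" and P: "partition_on V P"
  shows "homogeneous_mod E (anchor_refinement f V E P) (close_pairs V E P)"
proof (cases "P = {V}")
  case True
  then show ?thesis
    using homogeneous_trivial[OF E] anchor_refinement_trivial E unfolding fin_graph_def by metis
next
  case False
  have "{x, y} \<in> close_pairs V E P \<or> {x', y'} \<in> close_pairs V E P"
    if "agree f V E P x x'" "agree f V E P y y'" "{x, y} \<in> E" "x' \<noteq> y'" "{x', y'} \<notin> E" for x y x' y'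
  proof -
    have "x \<in> V" "y \<in> V" using that same_in[OF P] unfolding agree_def by blast+
    then obtain a b where "a \<in> anchors f V P" "same P x a" "b \<in> anchors f V P" "same P y b"
      using ex_anchor[OF P _ False] by metis
    then show ?thesis using not_mixed[OF P E, of x x' y y' b a] that unfolding agree_def by blast
  qed
  moreover have "agree f V E P x x'"
    if "X \<in> anchor_refinement f V E P" "x \<in> X" "x' \<in> X" for X x x'
    using that same_anchor_refinement[OF P, of f E x x'] unfolding same_def by blast
  ultimately show ?thesis unfolding homogeneous_mod_def by meson
qed

section \<open>Counting the refined parts that meet a ball\<close>

lemma flip_ball_neighbour:
  assumes P: "partition_on V P" and E: "fin_graph V E" and s: "same P x x'"
    and x: "x \<in> flip_ball V E P r v" "x' \<in> flip_ball V E P r v"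
    and a: "a \<in> V" "{a, x} \<in> E" "{a, x'} \<notin> E"
  shows "a \<in> flip_ball V E P (r + 1) v"
proof -
  have "a \<noteq> x" using E a(2) unfolding fin_graph_def nsets_def by (auto simp: card_2_iff)
  have "gdist (flip E F) a v \<le> enat (r + 1)" if F: "F \<subseteq> P \<times> P" for F
  proof -
    have d: "gdist (flip E F) x v \<le> enat r" "gdist (flip E F) x' v \<le> enat r"
      using x F unfolding flip_ball_def flip_dist_le_iff by auto
    show ?thesis
    proof (cases "a = x'")
      case True
      then show ?thesis using d(2) gdist_mono by fastforce
    next
      case False
      \<comment> \<open>The flip complements both of these pairs or neither, so one of them is an
        edge of the flip. Which one depends on \<open>F\<close>, but either way \<open>a\<close> is
        at most one step further out; this is the additional \<open>1\<close> in the radius.\<close>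
      have "{a, x} \<in> flip E F \<or> {a, x'} \<in> flip E F"
        using flip_uniform[OF P F same_refl[OF P a(1)] s \<open>a \<noteq> x\<close> False, of E] a by blast
      then show ?thesis using d gdist_trans[OF gdist_edge] by (metis add.commute)
    qed
  qed
  then show ?thesis using a(1) unfolding flip_ball_def flip_dist_le_iff by simp
qed

lemma card_nbhd_le_complexity:
  assumes "finite V" "A \<subseteq> V" "card A \<le> k"
  shows "card ((\<lambda>v. nbhd V E v \<inter> A) ` V) \<le> nbhd_complexity V E k"
proof -
  have "finite {card ((\<lambda>v. nbhd V E v \<inter> A) ` V) | A. A \<subseteq> V \<and> card A \<le> k}"
    using assms(1) by simp
  then show ?thesis unfolding nbhd_complexity_def using assms by (intro Max_ge) auto
qed

text \<open>A refined part meeting the ball is determined by its part of \<open>P\<close> and by the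
  trace on \<open>A\<close> of the neighbourhood of a representative in the ball, where
  \<open>A\<close> is the set of anchors in the larger flip ball. There are at most \<open>k\<close>
  choices for the part. As \<open>A\<close> has at most one anchor in each of at most
  \<open>k\<close> parts, there are at most \<open>nbhd_complexity V E k\<close> traces.\<close>

lemma card_refined_parts_le:
  assumes E: "fin_graph V E" and ref: "refines V P Q" and f: "inj_on f V"
    and k: "card (parts_meeting (flip_ball V E Q (6 * r + 1) v) P) \<le> k"
  shows "card (parts_meeting (gball V (close_pairs V E Q) r v) (anchor_refinement f V E P))
    \<le> k * nbhd_complexity V E k"
proof -
  have P: "partition_on V P" and Q: "partition_on V Q" using ref unfolding refines_def by auto
  have fin: "finite V" using E unfolding fin_graph_def by auto
  then have finP: "finite P" using P finite_elements by blast
  define B where "B = gball V (close_pairs V E Q) r v"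
  define B1 where "B1 = flip_ball V E Q (6 * r + 1) v"
  define A where "A = anchors f V P \<inter> B1"
  define part where "part x = (THE X. X \<in> P \<and> x \<in> X)" for x
  have part: "part x \<in> P \<and> x \<in> part x" if "x \<in> V" for x
    unfolding part_def
  proof (rule theI')
    show "\<exists>!X. X \<in> P \<and> x \<in> X"
      using that P part_unique[OF P] unfolding partition_on_def by blast
  qed
  have sp: "same P x y" if "x \<in> V" "y \<in> V" "part x = part y" for x y
    using part[OF that(1)] part[OF that(2)] that(3) unfolding same_def by metis
  have B: "B \<subseteq> flip_ball V E Q (6 * r) v"
    unfolding B_def by (rule close_ball_subset_flip_ball[OF E Q])
  also have "\<dots> \<subseteq> B1"
    unfolding B1_def flip_ball_def using order_trans by fastforce
  finally have BB1: "B \<subseteq> B1" .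
  have BV: "B \<subseteq> V" "B1 \<subseteq> V" "A \<subseteq> V"
    unfolding A_def B_def B1_def gball_def flip_ball_def by auto
  \<comment> \<open>Two anchors of one part both minimise \<open>f\<close> there, and
    \<open>f\<close> is injective.\<close>
  have "inj_on part A"
  proof (rule inj_onI)
    fix x y assume xy: "x \<in> A" "y \<in> A" "part x = part y"
    then have V: "x \<in> V" "y \<in> V" using BV(3) by auto
    then have "same P x y" "same P y x" using sp xy(3) by simp_all
    moreover have "x \<in> anchors f V P" "y \<in> anchors f V P" using xy unfolding A_def by simp_all
    ultimately have "\<not> f y < f x" "\<not> f x < f y" using V unfolding anchors_def by simp_all
    then have "f x = f y" by simp
    then show "x = y" using f V by (simp add: inj_on_eq_iff)
  qed
  moreover have "part ` A \<subseteq> parts_meeting B1 P"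
    using part BV unfolding parts_meeting_def A_def by blast
  ultimately have cA: "card A \<le> k"
    using k finP card_inj_on_le[of part A "parts_meeting B1 P"] unfolding B1_def parts_meeting_def
    by fastforce
  let ?M = "parts_meeting B (anchor_refinement f V E P)"
  define pick where "pick Z = (SOME x. x \<in> Z \<inter> B)" for Z
  have pick: "pick Z \<in> Z" "pick Z \<in> B" if "Z \<in> ?M" for Z
    using that someI_ex[of "\<lambda>x. x \<in> Z \<inter> B"] unfolding parts_meeting_def pick_def by auto
  define g where "g Z = (part (pick Z), nbhd V E (pick Z) \<inter> A)" for Z
  have "inj_on g ?M"
  proof (rule inj_onI)
    fix Z Z' assume Z: "Z \<in> ?M" "Z' \<in> ?M" and eq: "g Z = g Z'"
    let ?x = "pick Z" and ?y = "pick Z'"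
    have xy: "?x \<in> Z" "?y \<in> Z'" "?x \<in> B" "?y \<in> B" "?x \<in> V" "?y \<in> V" using pick Z BV by blast+
    then have s: "same P ?x ?y" using eq sp unfolding g_def by blast
    have b: "?x \<in> flip_ball V E Q (6 * r) v" "?y \<in> flip_ball V E Q (6 * r) v" using xy B by blast+
    have "{a, ?x} \<in> E \<longleftrightarrow> {a, ?y} \<in> E" if a: "a \<in> anchors f V P" for a
    proof (cases "a \<in> B1")
      case True
      then have "a \<in> nbhd V E ?x \<longleftrightarrow> a \<in> nbhd V E ?y" using eq a unfolding g_def A_def by blast
      then show ?thesis using BV True unfolding nbhd_def by blast
    next
      \<comment> \<open>An anchor telling the two representatives apart would lie within one step of
        the smaller ball. Either representative may be the neighbour, hence the two
        instances.\<close>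
      case False
      have "a \<in> V" using a unfolding anchors_def by simp
      then show ?thesis
        using False flip_ball_neighbour[OF Q E refines_same[OF ref s] b, of a]
          flip_ball_neighbour[OF Q E refines_same[OF ref same_sym[OF s]] b(2,1), of a]
        unfolding B1_def by blast
    qed
    then have "same (anchor_refinement f V E P) ?x ?y"
      using s unfolding same_anchor_refinement[OF P] agree_def by blast
    then obtain W where W: "W \<in> anchor_refinement f V E P" "?x \<in> W" "?y \<in> W"
      unfolding same_def by blast
    then show "Z = Z'"
      using xy Z part_unique[OF partition_on_anchor_refinement[OF P]] unfolding parts_meeting_def
      by (metis (no_types, lifting) mem_Collect_eq)
  qed
  moreover have "g ` ?M \<subseteq> parts_meeting B1 P \<times> (\<lambda>v. nbhd V E v \<inter> A) ` V"
  proof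
    fix p assume "p \<in> g ` ?M"
    then obtain Z where Z: "Z \<in> ?M" "p = (part (pick Z), nbhd V E (pick Z) \<inter> A)"
      unfolding g_def by blast
    have x: "pick Z \<in> B1" "pick Z \<in> V" using pick(2)[OF Z(1)] BB1 BV by auto
    then have "part (pick Z) \<in> parts_meeting B1 P"
      using part[OF x(2)] unfolding parts_meeting_def by blast
    then show "p \<in> parts_meeting B1 P \<times> (\<lambda>v. nbhd V E v \<inter> A) ` V" using Z(2) x(2) by simp
  qed
  moreover have "finite (parts_meeting B1 P \<times> (\<lambda>v. nbhd V E v \<inter> A) ` V)"
    using fin finP unfolding parts_meeting_def by simp
  ultimately have "card ?M \<le> card (parts_meeting B1 P \<times> (\<lambda>v. nbhd V E v \<inter> A) ` V)"
    by (rule card_inj_on_le)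
  also have "\<dots> \<le> k * nbhd_complexity V E k"
    using k card_nbhd_le_complexity[OF fin BV(3) cA] unfolding card_cartesian_product B1_def
    by (rule mult_le_mono)
  finally show ?thesis unfolding B_def .
qed

section \<open>The merge sequence and its properties\<close>

definition anchored_seq :: "('a \<Rightarrow> nat) \<Rightarrow> 'a set \<Rightarrow> 'a set set \<Rightarrow> 'a set set list \<Rightarrow> 'a mseq" where
  "anchored_seq f V E Ps = map (\<lambda>P. (anchor_refinement f V E P, close_pairs V E P)) Ps"

lemma merge_seq_anchored_seq:
  assumes E: "fin_graph V E" and Ps: "partition_seq V Ps"
  shows "merge_seq V E (anchored_seq f V E Ps)"
proof -
  have V: "V \<noteq> {}" using E unfolding fin_graph_def by auto
  have p: "Ps \<noteq> []" "\<And>P. P \<in> set Ps \<Longrightarrow> partition_on V P" "hd Ps = (\<lambda>v. {v}) ` V" "last Ps = {V}"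
    "\<And>t. Suc t < length Ps \<Longrightarrow> refines V (Ps ! t) (Ps ! Suc t)"
    using Ps unfolding partition_seq_def by auto
  have m: "map fst (anchored_seq f V E Ps) = map (anchor_refinement f V E) Ps"
    unfolding anchored_seq_def by simp
  have "partition_seq V (map fst (anchored_seq f V E Ps))"
    unfolding m partition_seq_def
    using p by (auto simp: partition_on_anchor_refinement hd_map last_map anchor_refinement_singletons
      anchor_refinement_trivial[OF V] anchor_refinement_mono)
  then show ?thesis
    unfolding merge_seq_def anchored_seq_def
    using p close_pairs_subset homogeneous_anchor_refinement[OF E] close_pairs_mono by fastforce
qed

text \<open>The two walks of a close pair bound its distance in the graph and in the complement,
  whatever the partition.\<close>

lemma firm_anchored_seq:
  assumes E: "fin_graph V E" and Ps: "partition_seq V Ps"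
  shows "firm 6 V E (anchored_seq f V E Ps)"
proof -
  have "snd (last (anchored_seq f V E Ps)) = close_pairs V E (last Ps)"
    using Ps unfolding partition_seq_def anchored_seq_def by (simp add: last_map)
  moreover have "gdist E u v \<le> enat 6 \<and> gdist (edge_complement V E) u v \<le> enat 6"
    if "{u, v} \<in> close_pairs V E P" for u v P
    using that linked_gdist[of V E P u v E] linked_gdist[of V "edge_complement V E" P u v "edge_complement V E"]
    unfolding mem_close_pairs_iff step_def by blast
  ultimately show ?thesis unfolding firm_def by metis
qed

lemma width_anchored_seq:
  assumes E: "fin_graph V E" and Ps: "partition_seq V Ps" and f: "inj_on f V"
    and k: "partition_seq_width (6 * r + 1) V E Ps \<le> k"
  shows "merge_seq_width r V (anchored_seq f V E Ps) \<le> k * nbhd_complexity V E k"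
proof -
  let ?W = "\<lambda>t v. card (parts_meeting (flip_ball V E (Ps ! Suc t) (6 * r + 1) v) (Ps ! t))"
  let ?S = "anchored_seq f V E Ps"
  let ?X = "{card (parts_meeting (gball V (snd (?S ! Suc t)) r v) (fst (?S ! t))) | t v.
            Suc t < length ?S \<and> v \<in> V}"
  have "{?W t v | t v. Suc t < length Ps \<and> v \<in> V} \<subseteq> (\<lambda>(t, v). ?W t v) ` ({..<length Ps} \<times> V)"
    by fastforce
  \<comment> \<open>Only for sets bounded above is the supremum on \<open>nat\<close> an upper
    bound.\<close>
  then have fin: "finite {?W t v | t v. Suc t < length Ps \<and> v \<in> V}"
    by (rule finite_subset) (use E in \<open>simp add: fin_graph_def\<close>)
  have "x \<le> k * nbhd_complexity V E k" if x: "x \<in> ?X" for x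
  proof -
    from x obtain t v where t: "Suc t < length Ps" "v \<in> V"
      "x = card (parts_meeting (gball V (close_pairs V E (Ps ! Suc t)) r v) (anchor_refinement f V E (Ps ! t)))"
      unfolding anchored_seq_def by auto
    have "?W t v \<le> partition_seq_width (6 * r + 1) V E Ps"
      unfolding partition_seq_width_def using t fin by (intro cSup_upper bdd_above_finite) auto
    then have "?W t v \<le> k" using k by simp
    moreover have "refines V (Ps ! t) (Ps ! Suc t)" using Ps t(1) unfolding partition_seq_def by blast
    ultimately show ?thesis using card_refined_parts_le[OF E _ f] t(3) by blast
  qed
  \<comment> \<open>A sequence of length one gives the empty set, whose supremum on
    \<open>nat\<close> is \<open>0\<close>.\<close>
  then show ?thesis
    unfolding merge_seq_width_def
    by (cases "?X = {}") (simp add: Sup_nat_def, rule cSup_least)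
qed

text \<open>The minimum is attained as soon as some partition sequence exists; the singletons
  followed by \<open>{V}\<close> form one.\<close>

lemma pmw_witness:
  assumes "fin_graph V E" "pmw r V E = k"
  obtains Ps where "partition_seq V Ps" "partition_seq_width r V E Ps = k"
proof -
  have V: "V \<noteq> {}" using assms(1) unfolding fin_graph_def by auto
  have "partition_on V {V}" "partition_on V ((\<lambda>v. {v}) ` V)"
    using V unfolding partition_on_def disjoint_def by auto
  then have "partition_seq V [(\<lambda>v. {v}) ` V, {V}]"
    unfolding partition_seq_def refines_def by (auto simp: less_Suc_eq)
  then have "\<exists>w Ps. partition_seq V Ps \<and> partition_seq_width r V E Ps = w" by blast
  from LeastI_ex[OF this] show thesis using that assms(2) unfolding pmw_def by blast
qed

section \<open>Evaluating first-order formulas\<close>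

definition halts :: "ram \<Rightarrow> ram_state \<Rightarrow> nat \<Rightarrow> (ram_state \<Rightarrow> bool) \<Rightarrow> bool" where
  "halts c s T Q \<longleftrightarrow> (\<exists>t s'. ram_exec c s t s' \<and> t \<le> T \<and> Q s')"

lemma halts_mono:
  "halts c s T Q \<Longrightarrow> T \<le> T' \<Longrightarrow> (\<And>s'. Q s' \<Longrightarrow> Q' s') \<Longrightarrow> halts c s T' Q'"
  unfolding halts_def by (meson order_trans)

lemma halts_Lit: "Q (\<rho>(x := c), \<mu>) \<Longrightarrow> 1 \<le> T \<Longrightarrow> halts (Lit x c) (\<rho>, \<mu>) T Q"
  unfolding halts_def using ram_exec.Lit by blast

lemma halts_Plus: "Q (\<rho>(x := \<rho> y + \<rho> z), \<mu>) \<Longrightarrow> 1 \<le> T \<Longrightarrow> halts (Plus x y z) (\<rho>, \<mu>) T Q"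
  unfolding halts_def using ram_exec.Plus by blast

lemma halts_Minus: "Q (\<rho>(x := \<rho> y - \<rho> z), \<mu>) \<Longrightarrow> 1 \<le> T \<Longrightarrow> halts (Minus x y z) (\<rho>, \<mu>) T Q"
  unfolding halts_def using ram_exec.Minus by blast

lemma halts_Load: "Q (\<rho>(x := \<mu> a (\<rho> y)), \<mu>) \<Longrightarrow> 1 \<le> T \<Longrightarrow> halts (Load x a y) (\<rho>, \<mu>) T Q"
  unfolding halts_def using ram_exec.Load by blast

lemma halts_Store:
  "Q (\<rho>, \<mu>(a := (\<mu> a)(\<rho> x := \<rho> y))) \<Longrightarrow> 1 \<le> T \<Longrightarrow> halts (Store a x y) (\<rho>, \<mu>) T Q"
  unfolding halts_def using ram_exec.Store by blast

text \<open>The postcondition of the first program is the \<open>halts\<close> statement of the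
  second, so that intermediate states need not be named.\<close>

lemma halts_Seq:
  assumes "halts c s T (\<lambda>s'. halts c' s' T' Q)"
  shows "halts (Seq c c') s (T + T') Q"
proof -
  from assms obtain t s' t' s'' where "ram_exec c s t s'" "t \<le> T" "ram_exec c' s' t' s''"
      "t' \<le> T'" "Q s''"
    unfolding halts_def by blast
  then show ?thesis unfolding halts_def
    by (intro exI[of _ "t + t'"] exI[of _ s'']) (simp add: ram_exec.Seq)
qed

lemma halts_Seq_step:
  assumes "halts c s 1 (\<lambda>s'. halts c' s' (T - 1) Q)" "1 \<le> T"
  shows "halts (Seq c c') s T Q"
  using halts_Seq[OF assms(1)] assms(2) by simp

lemma halts_Cond:
  assumes "fst s x \<noteq> 0 \<Longrightarrow> halts c s T Q" "fst s x = 0 \<Longrightarrow> halts c' s T Q"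
  shows "halts (Cond x c c') s (Suc T) Q"
  using assms unfolding halts_def
  by (cases "fst s x = 0") (meson CondTrue CondFalse Suc_le_mono)+

lemma halts_Loop_exit: "fst s x = 0 \<Longrightarrow> Q s \<Longrightarrow> 1 \<le> T \<Longrightarrow> halts (Loop x c) s T Q"
  unfolding halts_def using LoopFalse by blast

lemma halts_Loop_step:
  assumes "fst s x \<noteq> 0" "halts c s T (\<lambda>s'. halts (Loop x c) s' T' Q)"
  shows "halts (Loop x c) s (Suc (T + T')) Q"
proof -
  from assms obtain t s' t' s'' where "ram_exec c s t s'" "t \<le> T" "ram_exec (Loop x c) s' t' s''"
      "t' \<le> T'" "Q s''"
    unfolding halts_def by blast
  then show ?thesis unfolding halts_def using assms(1)
    by (intro exI[of _ "Suc (t + t')"] exI[of _ s'']) (simp add: LoopTrue)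
qed

text \<open>Throughout, register \<open>0\<close> holds the constant \<open>1\<close> and register \<open>1\<close> the number \<open>n\<close> of vertices.
  Register \<open>v\<close> runs through the vertices, and \<open>w\<close> holds the number of remaining ones.\<close>

definition for_vertex :: "nat \<Rightarrow> nat \<Rightarrow> ram \<Rightarrow> ram" where
  "for_vertex v w c = Seq (Lit v 0) (Seq (Minus w 1 v)
     (Loop w (Seq c (Seq (Plus v v 0) (Minus w 1 v)))))"

text \<open>Each round costs the body, two register updates and one test; the final \<open>3\<close>
  pays for the initialisation and the last test. The body must preserve \<open>v\<close> but may
  overwrite \<open>w\<close>, which is recomputed from \<open>v\<close>.\<close>

lemma halts_for_vertex:
  assumes inv: "I 0 (\<rho>, \<mu>)" "\<And>k \<rho> \<mu> a b. I k (\<rho>, \<mu>) \<Longrightarrow> I k (\<rho>(v := a, w := b), \<mu>)"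
      "\<And>k \<rho> \<mu>. I k (\<rho>, \<mu>) \<Longrightarrow> \<rho> 0 = 1 \<and> \<rho> 1 = n"
    and vw: "v \<noteq> w" "1 < v" "1 < w"
    and body: "\<And>k \<rho> \<mu>. k < n \<Longrightarrow> \<rho> v = k \<Longrightarrow> I k (\<rho>, \<mu>) \<Longrightarrow>
      halts c (\<rho>, \<mu>) T (\<lambda>(\<rho>', \<mu>'). \<rho>' v = k \<and> I (Suc k) (\<rho>', \<mu>'))"
  shows "halts (for_vertex v w c) (\<rho>, \<mu>) (n * (T + 3) + 3) (I n)"
proof -
  let ?c = "Seq c (Seq (Plus v v 0) (Minus w 1 v))"
  have loop: "halts (Loop w ?c) (\<rho>, \<mu>) ((n - k) * (T + 3) + 1) (I n)"
    if "k \<le> n" "\<rho> v = k" "\<rho> w = n - k" "I k (\<rho>, \<mu>)" for k \<rho> \<mu>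
    using that
  proof (induction "n - k" arbitrary: k \<rho> \<mu>)
    case 0
    then show ?case by (intro halts_Loop_exit) auto
  next
    case (Suc d)
    have "halts ?c (\<rho>, \<mu>) (T + 2)
      (\<lambda>s'. halts (Loop w ?c) s' ((n - Suc k) * (T + 3) + 1) (I n))"
    proof (rule halts_Seq, rule halts_mono[OF body[of k]])
      show "k < n" "\<rho> v = k" "I k (\<rho>, \<mu>)" "T \<le> T" using Suc by auto
      fix s' assume s': "case s' of (\<rho>', \<mu>') \<Rightarrow> \<rho>' v = k \<and> I (Suc k) (\<rho>', \<mu>')"
      obtain \<rho>' \<mu>' where [simp]: "s' = (\<rho>', \<mu>')" by (cases s')
      have 1: "\<rho>' v = k" "I (Suc k) (\<rho>', \<mu>')" "\<rho>' 0 = 1" "\<rho>' 1 = n" using s' inv(3) by auto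
      have "halts (Loop w ?c) (\<rho>'(v := Suc k, w := n - Suc k), \<mu>')
        ((n - Suc k) * (T + 3) + 1) (I n)"
        by (rule Suc.hyps(1)) (use Suc.hyps(2) inv(2)[OF 1(2)] vw in auto)
      then show "halts (Seq (Plus v v 0) (Minus w 1 v)) s' 2
        (\<lambda>s'. halts (Loop w ?c) s' ((n - Suc k) * (T + 3) + 1) (I n))"
        using 1 vw by (auto intro!: halts_Seq_step halts_Plus halts_Minus)
    qed
    then have "halts (Loop w ?c) (\<rho>, \<mu>) (Suc ((T + 2) + ((n - Suc k) * (T + 3) + 1))) (I n)"
      using Suc by (intro halts_Loop_step) auto
    moreover have "n - k = Suc (n - Suc k)" using Suc by simp
    ultimately show ?case by (auto elim: halts_mono)
  qed
  have "\<rho> 0 = 1" "\<rho> 1 = n" using inv by blast+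
  have "halts (Loop w ?c) (\<rho>(v := 0, w := n), \<mu>) ((n - 0) * (T + 3) + 1) (I n)"
    by (rule loop) (use inv(2)[OF inv(1)] vw in auto)
  then show ?thesis
    unfolding for_vertex_def using \<open>\<rho> 1 = n\<close> vw
    by (auto intro!: halts_Seq_step halts_Lit halts_Minus)
qed

section \<open>Formulas and their compilation\<close>

text \<open>A quantifier at depth \<open>d\<close> binds variable \<open>d\<close>, so the variables in scope at depth \<open>d\<close> are those
  below \<open>d\<close>.\<close>

datatype fm = Edge nat nat | Same nat nat | Less nat nat | Neg fm | Conj fm fm | Ex fm

fun holds :: "nat \<Rightarrow> (nat \<Rightarrow> nat \<Rightarrow> bool) \<Rightarrow> (nat \<Rightarrow> nat \<Rightarrow> bool) \<Rightarrow> nat \<Rightarrow> (nat \<Rightarrow> nat) \<Rightarrow> fm \<Rightarrow> bool" where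
  "holds n e q d \<sigma> (Edge x y) \<longleftrightarrow> e (\<sigma> x) (\<sigma> y)"
| "holds n e q d \<sigma> (Same x y) \<longleftrightarrow> q (\<sigma> x) (\<sigma> y)"
| "holds n e q d \<sigma> (Less x y) \<longleftrightarrow> \<sigma> x < \<sigma> y"
| "holds n e q d \<sigma> (Neg \<phi>) \<longleftrightarrow> \<not> holds n e q d \<sigma> \<phi>"
| "holds n e q d \<sigma> (Conj \<phi> \<psi>) \<longleftrightarrow> holds n e q d \<sigma> \<phi> \<and> holds n e q d \<sigma> \<psi>"
| "holds n e q d \<sigma> (Ex \<phi>) \<longleftrightarrow> (\<exists>a<n. holds n e q (Suc d) (\<sigma>(d := a)) \<phi>)"

fun closed_below :: "nat \<Rightarrow> fm \<Rightarrow> bool" where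
  "closed_below d (Edge x y) \<longleftrightarrow> x < d \<and> y < d"
| "closed_below d (Same x y) \<longleftrightarrow> x < d \<and> y < d"
| "closed_below d (Less x y) \<longleftrightarrow> x < d \<and> y < d"
| "closed_below d (Neg \<phi>) \<longleftrightarrow> closed_below d \<phi>"
| "closed_below d (Conj \<phi> \<psi>) \<longleftrightarrow> closed_below d \<phi> \<and> closed_below d \<psi>"
| "closed_below d (Ex \<phi>) \<longleftrightarrow> closed_below (Suc d) \<phi>"

text \<open>Registers of variables out of scope contain leftovers of earlier evaluations, which must
  not influence the truth value.\<close>

lemma holds_cong:
  "closed_below d \<phi> \<Longrightarrow> (\<And>x. x < d \<Longrightarrow> \<sigma> x = \<tau> x) \<Longrightarrow> holds n e q d \<sigma> \<phi> = holds n e q d \<tau> \<phi>"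
proof (induction \<phi> arbitrary: d \<sigma> \<tau>)
  case (Ex \<phi>)
  have "holds n e q (Suc d) (\<sigma>(d := a)) \<phi> = holds n e q (Suc d) (\<tau>(d := a)) \<phi>" for a
    by (rule Ex.IH) (use Ex.prems in auto)
  then show ?case by simp
next
  case (Neg \<phi>)
  show ?case using Neg.IH[of d \<sigma> \<tau>] Neg.prems(1) by (simp add: Neg.prems(2))
next
  case (Conj \<phi> \<psi>)
  show ?case
    using Conj.IH(1)[of d \<sigma> \<tau>] Conj.IH(2)[of d \<sigma> \<tau>] Conj.prems(1) by (simp add: Conj.prems(2))
qed simp_all

text \<open>Depth \<open>d\<close> owns the three registers from \<open>8 + 3 * d\<close> on: the truth value of the formula, the
  variable bound there and its loop counter.\<close>

abbreviation res :: "nat \<Rightarrow> nat" where "res d \<equiv> 8 + 3 * d"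
abbreviation var :: "nat \<Rightarrow> nat" where "var d \<equiv> 9 + 3 * d"
abbreviation cnt :: "nat \<Rightarrow> nat" where "cnt d \<equiv> 10 + 3 * d"

text \<open>Without multiplication, the row offset has to be read from a table. The address is
  assembled in the register that receives the result.\<close>

definition lookup :: "nat \<Rightarrow> nat \<Rightarrow> nat \<Rightarrow> nat \<Rightarrow> ram" where
  "lookup b d x y = Seq (Load (res d) 2 (var x)) (Seq (Plus (res d) (res d) (var y))
     (Seq (Plus (res d) (res d) b) (Load (res d) 0 (res d))))"

text \<open>Any nonzero number stands for truth, so truncated subtraction gives both
  \<open>Less\<close> and \<open>Neg\<close>. In \<open>Ex\<close>, clearing
  \<open>res (Suc d)\<close> is an idle branch: the value there has just been consumed.\<close>

fun compile :: "nat \<Rightarrow> fm \<Rightarrow> ram" where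
  "compile d (Edge x y) = lookup 2 d x y"
| "compile d (Same x y) = lookup 3 d x y"
| "compile d (Less x y) = Minus (res d) (var y) (var x)"
| "compile d (Neg \<phi>) = Seq (compile d \<phi>) (Minus (res d) 0 (res d))"
| "compile d (Conj \<phi> \<psi>) = Seq (compile d \<phi>) (Cond (res d) (compile d \<psi>) (Lit (res d) 0))"
| "compile d (Ex \<phi>) = Seq (Lit (res d) 0) (for_vertex (var d) (cnt d)
     (Seq (compile (Suc d) \<phi>)
       (Cond (res (Suc d)) (Lit (res d) 1) (Lit (res (Suc d)) 0))))"

text \<open>The indeterminate is the number of vertices. Each quantifier contributes one factor of
  it, so a fixed formula is evaluated in polynomial time.\<close>

fun cost :: "fm \<Rightarrow> nat poly" where
  "cost (Edge x y) = [:4:]"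
| "cost (Same x y) = [:4:]"
| "cost (Less x y) = [:1:]"
| "cost (Neg \<phi>) = cost \<phi> + [:1:]"
| "cost (Conj \<phi> \<psi>) = cost \<phi> + cost \<psi> + [:2:]"
| "cost (Ex \<phi>) = [:0, 1:] * (cost \<phi> + [:5:]) + [:4:]"

text \<open>Array \<open>2\<close> tabulates the multiples of \<open>n\<close>; the matrices of \<open>e\<close> and \<open>q\<close> are stored in array \<open>0\<close>
  from the addresses in registers \<open>2\<close> and \<open>3\<close> on.\<close>

definition ready :: "nat \<Rightarrow> (nat \<Rightarrow> nat \<Rightarrow> bool) \<Rightarrow> (nat \<Rightarrow> nat \<Rightarrow> bool) \<Rightarrow>
    (nat \<Rightarrow> nat) \<Rightarrow> (nat \<Rightarrow> nat \<Rightarrow> nat) \<Rightarrow> bool" where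
  "ready n e q \<rho> \<mu> \<longleftrightarrow> \<rho> 0 = 1 \<and> \<rho> 1 = n \<and> (\<forall>i<n. \<mu> 2 i = i * n) \<and>
     (\<forall>i<n. \<forall>j<n. \<mu> 0 (i * n + j + \<rho> 2) \<noteq> 0 \<longleftrightarrow> e i j) \<and>
     (\<forall>i<n. \<forall>j<n. \<mu> 0 (i * n + j + \<rho> 3) \<noteq> 0 \<longleftrightarrow> q i j)"

lemma ready_cong:
  "ready n e q \<rho> \<mu> \<Longrightarrow> (\<And>x. x < 4 \<Longrightarrow> \<rho>' x = \<rho> x) \<Longrightarrow> \<mu>' 0 = \<mu> 0 \<Longrightarrow> \<mu>' 2 = \<mu> 2 \<Longrightarrow>
    ready n e q \<rho>' \<mu>'"
  unfolding ready_def by simp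

lemma halts_lookup:
  assumes "\<mu> 2 (\<rho> (var x)) = \<rho> (var x) * \<rho> 1" "b < 8" "y < d"
    "Q (\<rho>(res d := \<mu> 0 (\<rho> (var x) * \<rho> 1 + \<rho> (var y) + \<rho> b)), \<mu>)"
  shows "halts (lookup b d x y) (\<rho>, \<mu>) 4 Q"
proof -
  \<comment> \<open>Building the address in \<open>res d\<close> destroys neither the base address
    nor the variable still to be added.\<close>
  have "res d \<noteq> b" "res d \<noteq> var y" using assms(2,3) by presburger+
  then show ?thesis
    using assms unfolding lookup_def
    by (auto intro!: halts_Seq_step halts_Load halts_Plus)
qed

text \<open>Keeping all registers below \<open>res d\<close> intact is what carries the induction:
  it protects the variables of enclosing scopes and the truth values accumulated by enclosing
  quantifiers.\<close>

lemma halts_compile: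
  assumes "closed_below d \<phi>" "ready n e q \<rho> \<mu>" "\<And>x. x < d \<Longrightarrow> \<rho> (var x) < n"
  shows "halts (compile d \<phi>) (\<rho>, \<mu>) (poly (cost \<phi>) n) (\<lambda>(\<rho>', \<mu>'). \<mu>' = \<mu> \<and>
    (\<forall>x<res d. \<rho>' x = \<rho> x) \<and> (\<rho>' (res d) \<noteq> 0 \<longleftrightarrow> holds n e q d (\<lambda>x. \<rho> (var x)) \<phi>))"
  using assms
proof (induction \<phi> arbitrary: d \<rho> \<mu>)
  case (Edge x y)
  then have "\<rho> (var x) < n" "\<rho> (var y) < n" by auto
  then show ?case using Edge by (auto intro!: halts_lookup simp: ready_def)
next
  case (Same x y)
  then have "\<rho> (var x) < n" "\<rho> (var y) < n" by auto
  then show ?case using Same by (auto intro!: halts_lookup simp: ready_def)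
next
  case (Less x y)
  then show ?case by (auto intro!: halts_Minus)
next
  case (Neg \<phi>)
  have "halts (compile d \<phi>) (\<rho>, \<mu>) (poly (cost \<phi>) n) (\<lambda>s'. halts (Minus (res d) 0 (res d)) s' 1
    (\<lambda>(\<rho>', \<mu>'). \<mu>' = \<mu> \<and> (\<forall>x<res d. \<rho>' x = \<rho> x) \<and>
      (\<rho>' (res d) \<noteq> 0 \<longleftrightarrow> holds n e q d (\<lambda>x. \<rho> (var x)) (Neg \<phi>))))"
  proof (rule halts_mono[OF Neg.IH[OF _ Neg.prems(2,3)] order_refl])
    have one: "\<rho> 0 = 1" using Neg.prems(2) unfolding ready_def by simp
    show "closed_below d \<phi>" using Neg.prems(1) by simp
    fix s' assume "case s' of (\<rho>', \<mu>') \<Rightarrow> \<mu>' = \<mu> \<and> (\<forall>x<res d. \<rho>' x = \<rho> x) \<and>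
      (\<rho>' (res d) \<noteq> 0 \<longleftrightarrow> holds n e q d (\<lambda>x. \<rho> (var x)) \<phi>)"
    then show "halts (Minus (res d) 0 (res d)) s' 1 (\<lambda>(\<rho>', \<mu>'). \<mu>' = \<mu> \<and>
      (\<forall>x<res d. \<rho>' x = \<rho> x) \<and>
      (\<rho>' (res d) \<noteq> 0 \<longleftrightarrow> holds n e q d (\<lambda>x. \<rho> (var x)) (Neg \<phi>)))"
      using one by (cases s') (auto intro!: halts_Minus)
  qed
  from halts_Seq[OF this] show ?case by simp
next
  case (Conj \<phi> \<psi>)
  let ?Q = "\<lambda>(\<rho>', \<mu>'). \<mu>' = \<mu> \<and> (\<forall>x<res d. \<rho>' x = \<rho> x) \<and>
      (\<rho>' (res d) \<noteq> 0 \<longleftrightarrow> holds n e q d (\<lambda>x. \<rho> (var x)) (Conj \<phi> \<psi>))"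
  have "halts (compile d \<phi>) (\<rho>, \<mu>) (poly (cost \<phi>) n)
    (\<lambda>s'. halts (Cond (res d) (compile d \<psi>) (Lit (res d) 0)) s' (Suc (poly (cost \<psi>) n + 1)) ?Q)"
  proof (rule halts_mono[OF Conj.IH(1)[OF _ Conj.prems(2,3)] order_refl])
    show "closed_below d \<phi>" using Conj.prems by simp
    fix s' assume s': "case s' of (\<rho>', \<mu>') \<Rightarrow> \<mu>' = \<mu> \<and> (\<forall>x<res d. \<rho>' x = \<rho> x) \<and>
      (\<rho>' (res d) \<noteq> 0 \<longleftrightarrow> holds n e q d (\<lambda>x. \<rho> (var x)) \<phi>)"
    then obtain \<rho>' where r: "s' = (\<rho>', \<mu>)" "\<And>x. x < res d \<Longrightarrow> \<rho>' x = \<rho> x"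
      "\<rho>' (res d) \<noteq> 0 \<longleftrightarrow> holds n e q d (\<lambda>x. \<rho> (var x)) \<phi>" by (cases s') auto
    show "halts (Cond (res d) (compile d \<psi>) (Lit (res d) 0)) s' (Suc (poly (cost \<psi>) n + 1)) ?Q"
    proof (rule halts_Cond)
      assume "fst s' (res d) \<noteq> 0"
      then have \<phi>: "holds n e q d (\<lambda>x. \<rho> (var x)) \<phi>" using r by simp
      have v: "\<rho>' (var x) = \<rho> (var x)" if "x < d" for x using that r(2) by simp
      have h: "holds n e q d (\<lambda>x. \<rho>' (var x)) \<psi> = holds n e q d (\<lambda>x. \<rho> (var x)) \<psi>"
        by (rule holds_cong) (use Conj.prems v in auto)
      have "halts (compile d \<psi>) (\<rho>', \<mu>) (poly (cost \<psi>) n) (\<lambda>(\<rho>'', \<mu>'). \<mu>' = \<mu> \<and>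
          (\<forall>x<res d. \<rho>'' x = \<rho>' x) \<and> (\<rho>'' (res d) \<noteq> 0 \<longleftrightarrow> holds n e q d (\<lambda>x. \<rho>' (var x)) \<psi>))"
        by (rule Conj.IH(2)) (use Conj.prems r v in \<open>auto intro: ready_cong\<close>)
      then show "halts (compile d \<psi>) s' (poly (cost \<psi>) n + 1) ?Q"
        unfolding r(1) by (rule halts_mono) (use r \<phi> h in auto)
    next
      assume "fst s' (res d) = 0"
      then show "halts (Lit (res d) 0) s' (poly (cost \<psi>) n + 1) ?Q"
        using r by (auto intro!: halts_Lit)
    qed
  qed
  from halts_Seq[OF this] show ?case by (simp add: algebra_simps)
next
  case (Ex \<phi>)
  let ?\<sigma> = "\<lambda>x. \<rho> (var x)"
  let ?h = "\<lambda>a. holds n e q (Suc d) (?\<sigma>(d := a)) \<phi>"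
  let ?c = "Cond (res (Suc d)) (Lit (res d) 1) (Lit (res (Suc d)) 0)"
  \<comment> \<open>After \<open>k\<close> rounds the register tells whether there is a witness
    below \<open>k\<close>.\<close>
  define I where "I k = (\<lambda>(\<rho>', \<mu>'). \<mu>' = \<mu> \<and> (\<forall>x<res d. \<rho>' x = \<rho> x) \<and>
    (\<rho>' (res d) \<noteq> 0 \<longleftrightarrow> (\<exists>a<k. ?h a)))" for k
  have "halts (for_vertex (var d) (cnt d) (Seq (compile (Suc d) \<phi>) ?c)) (\<rho>(res d := 0), \<mu>)
    (n * (poly (cost \<phi>) n + 2 + 3) + 3) (I n)"
  proof (rule halts_for_vertex)
    show "I 0 (\<rho>(res d := 0), \<mu>)" unfolding I_def by auto
    show "I k (\<rho>(var d := a, cnt d := b), \<mu>)" if "I k (\<rho>, \<mu>)" for k \<rho> \<mu> a b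
      using that unfolding I_def by auto
    show "\<rho>' 0 = 1 \<and> \<rho>' 1 = n" if "I k (\<rho>', \<mu>')" for k \<rho>' \<mu>'
      using that Ex.prems(2) unfolding I_def ready_def by auto
    show "var d \<noteq> cnt d" "1 < var d" "1 < cnt d" by auto
    show "halts (Seq (compile (Suc d) \<phi>) ?c) (\<rho>', \<mu>') (poly (cost \<phi>) n + 2)
      (\<lambda>(\<rho>'', \<mu>''). \<rho>'' (var d) = k \<and> I (Suc k) (\<rho>'', \<mu>''))"
      if k: "k < n" "\<rho>' (var d) = k" "I k (\<rho>', \<mu>')" for k \<rho>' \<mu>'
    proof (rule halts_Seq, rule halts_mono[OF Ex.IH])
      have I: "\<mu>' = \<mu>" "\<And>x. x < res d \<Longrightarrow> \<rho>' x = \<rho> x" "\<rho>' (res d) \<noteq> 0 \<longleftrightarrow> (\<exists>a<k. ?h a)"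
        using k(3) unfolding I_def by auto
      show "closed_below (Suc d) \<phi>" using Ex.prems by simp
      show "ready n e q \<rho>' \<mu>'" by (rule ready_cong[OF Ex.prems(2)]) (use I in auto)
      show "\<rho>' (var x) < n" if "x < Suc d" for x
        using that k I(2)[of "var x"] Ex.prems(3)[of x] by (cases "x = d") auto
      have h: "holds n e q (Suc d) (\<lambda>x. \<rho>' (var x)) \<phi> = ?h k"
        by (rule holds_cong) (use Ex.prems k I(2) in \<open>auto simp: less_Suc_eq\<close>)
      fix s' assume "case s' of (\<rho>'', \<mu>'') \<Rightarrow> \<mu>'' = \<mu>' \<and> (\<forall>x<res (Suc d). \<rho>'' x = \<rho>' x) \<and>
        (\<rho>'' (res (Suc d)) \<noteq> 0 \<longleftrightarrow> holds n e q (Suc d) (\<lambda>x. \<rho>' (var x)) \<phi>)"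
      then obtain \<rho>'' where r: "s' = (\<rho>'', \<mu>)" "\<And>x. x < res (Suc d) \<Longrightarrow> \<rho>'' x = \<rho>' x"
        "\<rho>'' (res (Suc d)) \<noteq> 0 \<longleftrightarrow> ?h k" using h I(1) by (cases s') auto
      have r': "\<rho>'' (var d) = k" "\<And>x. x < res d \<Longrightarrow> \<rho>'' x = \<rho> x" "\<rho>'' (res d) = \<rho>' (res d)"
        using r(2) k(2) I(2) by auto
      have "halts ?c s' (Suc 1) (\<lambda>(\<rho>'', \<mu>''). \<rho>'' (var d) = k \<and> I (Suc k) (\<rho>'', \<mu>''))"
      proof (rule halts_Cond)
        assume "fst s' (res (Suc d)) \<noteq> 0"
        then have "?h k" using r by simp
        then show "halts (Lit (res d) 1) s' 1 (\<lambda>(\<rho>'', \<mu>''). \<rho>'' (var d) = k \<and> I (Suc k) (\<rho>'', \<mu>''))"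
          unfolding r(1) using r' by (intro halts_Lit) (auto simp: I_def)
      next
        assume "fst s' (res (Suc d)) = 0"
        then have "\<not> ?h k" using r by simp
        then have "(\<exists>a<Suc k. ?h a) \<longleftrightarrow> (\<exists>a<k. ?h a)"
          using less_Suc_eq by (metis (no_types, lifting))
        then show "halts (Lit (res (Suc d)) 0) s' 1
            (\<lambda>(\<rho>'', \<mu>''). \<rho>'' (var d) = k \<and> I (Suc k) (\<rho>'', \<mu>''))"
          unfolding r(1) using r' I(3) by (intro halts_Lit) (auto simp: I_def)
      qed
      then show "halts ?c s' 2 (\<lambda>(\<rho>'', \<mu>''). \<rho>'' (var d) = k \<and> I (Suc k) (\<rho>'', \<mu>''))"
        by (simp add: numeral_2_eq_2)
    qed simp
  qed
  then have "halts (compile d (Ex \<phi>)) (\<rho>, \<mu>) (1 + (n * (poly (cost \<phi>) n + 2 + 3) + 3)) (I n)"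
    unfolding compile.simps by (intro halts_Seq halts_Lit) simp_all
  then show ?case
    by (rule halts_mono) (auto simp: I_def algebra_simps)
qed

section \<open>Writing the matrix that a formula defines\<close>

definition put_cell :: "fm \<Rightarrow> ram" where
  "put_cell \<phi> = Seq (compile 2 \<phi>) (Seq (Cond 14 (Lit 14 1) (Lit 14 0))
     (Seq (Store 1 5 14) (Plus 5 5 0)))"

definition put_matrix :: "fm \<Rightarrow> ram" where
  "put_matrix \<phi> = for_vertex (var 0) (cnt 0) (for_vertex (var 1) (cnt 1) (put_cell \<phi>))"

text \<open>Register \<open>5\<close> holds the next free address of the output array.\<close>

definition emitted :: "(nat \<Rightarrow> nat) \<Rightarrow> (nat \<Rightarrow> nat \<Rightarrow> nat) \<Rightarrow> nat list \<Rightarrow> ram_state \<Rightarrow> bool" where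
  "emitted \<rho> \<mu> ys = (\<lambda>(\<rho>', \<mu>'). (\<forall>x<8. x \<noteq> 5 \<longrightarrow> \<rho>' x = \<rho> x) \<and> (\<forall>a. a \<noteq> 1 \<longrightarrow> \<mu>' a = \<mu> a) \<and>
     \<rho>' 5 = Suc (length ys) \<and> (\<forall>i<length ys. \<mu>' 1 (Suc i) = ys ! i))"

lemma emitted_upd: "emitted \<rho> \<mu> ys (\<rho>', \<mu>') \<Longrightarrow> 8 \<le> x \<Longrightarrow> emitted \<rho> \<mu> ys (\<rho>'(x := a), \<mu>')"
  unfolding emitted_def by auto

lemma emitted_ready: "emitted \<rho> \<mu> ys (\<rho>', \<mu>') \<Longrightarrow> ready n e q \<rho> \<mu> \<Longrightarrow> ready n e q \<rho>' \<mu>'"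
  by (erule ready_cong) (auto simp: emitted_def)

abbreviation pair_env :: "nat \<Rightarrow> nat \<Rightarrow> nat \<Rightarrow> nat" where
  "pair_env i j \<equiv> (\<lambda>_. 0)(0 := i, 1 := j)"

lemma halts_put_cell:
  assumes wf: "closed_below 2 \<phi>" and rd: "ready n e q \<rho> \<mu>" and em: "emitted \<rho> \<mu> ys (\<rho>', \<mu>')"
    and ij: "\<rho>' 9 = i" "\<rho>' 12 = j" "i < n" "j < n"
  shows "halts (put_cell \<phi>) (\<rho>', \<mu>') (poly (cost \<phi>) n + 4) (\<lambda>(\<rho>'', \<mu>'').
    \<rho>'' 9 = i \<and> \<rho>'' 12 = j \<and>
    emitted \<rho> \<mu> (ys @ [of_bool (holds n e q 2 (pair_env i j) \<phi>)]) (\<rho>'', \<mu>''))"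
    (is "halts _ _ _ ?Q")
proof -
  let ?h = "holds n e q 2 (pair_env i j) \<phi>"
  have rd': "ready n e q \<rho>' \<mu>'" using em rd by (rule emitted_ready)
  \<comment> \<open>Registers \<open>9\<close> and \<open>12\<close> are \<open>var 0\<close> and
    \<open>var 1\<close>.\<close>
  have h: "holds n e q 2 (\<lambda>x. \<rho>' (var x)) \<phi> = ?h"
    by (rule holds_cong[OF wf]) (use ij in \<open>auto simp: less_2_cases_iff\<close>)
  have "halts (compile 2 \<phi>) (\<rho>', \<mu>') (poly (cost \<phi>) n)
    (\<lambda>s. halts (Seq (Cond 14 (Lit 14 1) (Lit 14 0)) (Seq (Store 1 5 14) (Plus 5 5 0))) s 4 ?Q)"
  proof (rule halts_mono[OF halts_compile[OF wf rd']])
    show "\<rho>' (var x) < n" if "x < 2" for x using that ij by (auto simp: less_2_cases_iff)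
    fix s assume "case s of (\<rho>'', \<mu>'') \<Rightarrow> \<mu>'' = \<mu>' \<and> (\<forall>x<res 2. \<rho>'' x = \<rho>' x) \<and>
      (\<rho>'' (res 2) \<noteq> 0 \<longleftrightarrow> holds n e q 2 (\<lambda>x. \<rho>' (var x)) \<phi>)"
    then obtain \<rho>'' where r: "s = (\<rho>'', \<mu>')" "\<And>x. x < 14 \<Longrightarrow> \<rho>'' x = \<rho>' x" "\<rho>'' 14 \<noteq> 0 \<longleftrightarrow> ?h"
      using h by (cases s) auto
    have one: "\<rho>'' 0 = 1" using r(2)[of 0] rd' unfolding ready_def by simp
    have em'': "emitted \<rho> \<mu> ys (\<rho>'', \<mu>')" using em r(2) unfolding emitted_def by simp
    have fin: "?Q (\<rho>''(14 := of_bool ?h, 5 := \<rho>'' 5 + 1), \<mu>'(1 := (\<mu>' 1)(\<rho>'' 5 := of_bool ?h)))"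
      using em'' r(2) ij unfolding emitted_def by (auto simp: nth_append less_Suc_eq)
    \<comment> \<open>Register \<open>14\<close> is \<open>res 2\<close>; the test normalises its
      truth value to a matrix entry \<open>0\<close> or \<open>1\<close>.\<close>
    have "halts (Cond 14 (Lit 14 1) (Lit 14 0)) s (Suc 1)
      (\<lambda>s. halts (Seq (Store 1 5 14) (Plus 5 5 0)) s 2 ?Q)"
      unfolding r(1) using fin r(3) one
      by (intro halts_Cond halts_Lit halts_Seq_step halts_Store halts_Plus) simp_all
    from halts_Seq[OF this]
    show "halts (Seq (Cond 14 (Lit 14 1) (Lit 14 0)) (Seq (Store 1 5 14) (Plus 5 5 0))) s 4 ?Q"
      by (simp add: numeral_eq_Suc)
  qed simp
  then show ?thesis unfolding put_cell_def by (rule halts_Seq)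
qed

lemma enc_matrix_eq: "enc_matrix n Q = concat (map (\<lambda>i. map (\<lambda>j. of_bool (Q i j)) [0..<n]) [0..<n])"
  unfolding enc_matrix_def by simp

lemma halts_put_matrix:
  assumes wf: "closed_below 2 \<phi>" and rd: "ready n e q \<rho> \<mu>" and em: "emitted \<rho> \<mu> ys (\<rho>', \<mu>')"
  shows "halts (put_matrix \<phi>) (\<rho>', \<mu>') (n * (n * (poly (cost \<phi>) n + 4 + 3) + 3 + 3) + 3)
    (emitted \<rho> \<mu> (ys @ enc_matrix n (\<lambda>i j. holds n e q 2 (pair_env i j) \<phi>)))"
proof -
  let ?b = "\<lambda>i j. of_bool (holds n e q 2 (pair_env i j) \<phi>) :: nat"
  let ?rows = "\<lambda>i. concat (map (\<lambda>i. map (?b i) [0..<n]) [0..<i])"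
  have const: "\<rho>' 0 = 1 \<and> \<rho>' 1 = n" if "emitted \<rho> \<mu> zs (\<rho>', \<mu>')" for \<rho>' \<mu>' zs
    using emitted_ready[OF that rd] unfolding ready_def by simp
  have row: "halts (for_vertex (var 1) (cnt 1) (put_cell \<phi>)) (\<rho>', \<mu>')
      (n * (poly (cost \<phi>) n + 4 + 3) + 3)
      (\<lambda>(\<rho>'', \<mu>''). \<rho>'' (var 0) = i \<and> emitted \<rho> \<mu> (zs @ map (?b i) [0..<n]) (\<rho>'', \<mu>''))"
    if i: "i < n" "\<rho>' (var 0) = i" "emitted \<rho> \<mu> zs (\<rho>', \<mu>')" for i zs \<rho>' \<mu>'
  \<comment> \<open>The inner invariant also records \<open>var 0\<close>, since the outer loop
    requires its body to preserve it.\<close>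
  proof (rule halts_for_vertex[where I = "\<lambda>k (\<rho>'', \<mu>''). \<rho>'' (var 0) = i \<and>
      emitted \<rho> \<mu> (zs @ map (?b i) [0..<k]) (\<rho>'', \<mu>'')"])
    fix k \<rho>'' \<mu>''
    assume "k < n" "\<rho>'' (var 1) = k" "case (\<rho>'', \<mu>'') of (\<rho>'', \<mu>'') \<Rightarrow> \<rho>'' (var 0) = i \<and>
      emitted \<rho> \<mu> (zs @ map (?b i) [0..<k]) (\<rho>'', \<mu>'')"
    then show "halts (put_cell \<phi>) (\<rho>'', \<mu>'') (poly (cost \<phi>) n + 4)
      (\<lambda>(\<rho>', \<mu>'). \<rho>' (var 1) = k \<and> (case (\<rho>', \<mu>') of (\<rho>'', \<mu>'') \<Rightarrow> \<rho>'' (var 0) = i \<and>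
        emitted \<rho> \<mu> (zs @ map (?b i) [0..<Suc k]) (\<rho>'', \<mu>'')))"
      using halts_put_cell[OF wf rd, of "zs @ map (?b i) [0..<k]" \<rho>'' \<mu>'' i k] i(1)
      by (auto elim!: halts_mono)
  next
    show "\<rho>' 0 = 1 \<and> \<rho>' 1 = n" if "case (\<rho>', \<mu>') of (\<rho>'', \<mu>'') \<Rightarrow> \<rho>'' (var 0) = i \<and>
      emitted \<rho> \<mu> (zs @ map (?b i) [0..<k]) (\<rho>'', \<mu>'')" for k \<rho>' \<mu>'
      using that const[of _ \<rho>' \<mu>'] by blast
  qed (use i in \<open>auto intro!: emitted_upd\<close>)
  have "halts (put_matrix \<phi>) (\<rho>', \<mu>') (n * (n * (poly (cost \<phi>) n + 4 + 3) + 3 + 3) + 3)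
    (emitted \<rho> \<mu> (ys @ ?rows n))"
    unfolding put_matrix_def
  proof (rule halts_for_vertex[where I = "\<lambda>k. emitted \<rho> \<mu> (ys @ ?rows k)"])
    fix k \<rho>'' \<mu>''
    assume "k < n" "\<rho>'' (var 0) = k" "emitted \<rho> \<mu> (ys @ ?rows k) (\<rho>'', \<mu>'')"
    from row[OF this] show "halts (for_vertex (var 1) (cnt 1) (put_cell \<phi>)) (\<rho>'', \<mu>'')
      (n * (poly (cost \<phi>) n + 4 + 3) + 3)
      (\<lambda>(\<rho>', \<mu>'). \<rho>' (var 0) = k \<and> emitted \<rho> \<mu> (ys @ ?rows (Suc k)) (\<rho>', \<mu>'))"
      by simp
  next
    show "\<rho>' 0 = 1 \<and> \<rho>' 1 = n" if "emitted \<rho> \<mu> (ys @ ?rows k) (\<rho>', \<mu>')" for k \<rho>' \<mu>'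
      using that by (rule const)
  qed (use em in \<open>auto intro!: emitted_upd\<close>)
  then show ?thesis unfolding enc_matrix_eq .
qed

section \<open>Computing the merge sequence\<close>

abbreviation Eq :: "nat \<Rightarrow> nat \<Rightarrow> fm" where
  "Eq x y \<equiv> Conj (Neg (Less x y)) (Neg (Less y x))"

abbreviation Disj :: "fm \<Rightarrow> fm \<Rightarrow> fm" where
  "Disj \<phi> \<psi> \<equiv> Neg (Conj (Neg \<phi>) (Neg \<psi>))"

abbreviation Non_edge :: "nat \<Rightarrow> nat \<Rightarrow> fm" where
  "Non_edge x y \<equiv> Neg (Edge x y)"

text \<open>Variables \<open>0\<close> and \<open>1\<close> are the given pair throughout.
  \<open>linked_fm\<close> binds the inner vertices of the walk as \<open>2\<close> to
  \<open>5\<close>, and \<open>anchor_fm\<close> is read at depth three with variable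
  \<open>2\<close> as the candidate.\<close>

definition step_fm :: "(nat \<Rightarrow> nat \<Rightarrow> fm) \<Rightarrow> nat \<Rightarrow> nat \<Rightarrow> fm" where
  "step_fm h x y = Disj (Eq x y) (Conj (h x y)
     (Disj (Conj (Same 0 x) (Same 1 y)) (Conj (Same 1 x) (Same 0 y))))"

definition linked_fm :: "(nat \<Rightarrow> nat \<Rightarrow> fm) \<Rightarrow> fm" where
  "linked_fm h = Ex (Ex (Ex (Ex (Conj (step_fm h 0 2) (Conj (step_fm h 2 3)
     (Conj (step_fm h 3 4) (Conj (step_fm h 4 5) (step_fm h 5 1))))))))"

definition close_fm :: fm where
  "close_fm = Conj (Neg (Eq 0 1)) (Conj (linked_fm Edge) (linked_fm Non_edge))"

definition anchor_fm :: fm where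
  "anchor_fm = Conj (Ex (Ex (Neg (Same 3 4)))) (Neg (Ex (Conj (Same 2 3) (Less 3 2))))"

definition agree_fm :: fm where
  "agree_fm = Conj (Same 0 1) (Neg (Ex (Conj anchor_fm
     (Disj (Conj (Edge 2 0) (Non_edge 2 1)) (Conj (Non_edge 2 0) (Edge 2 1))))))"

lemma closed_agree_fm: "closed_below 2 agree_fm"
  unfolding agree_fm_def anchor_fm_def by simp

lemma closed_close_fm: "closed_below 2 close_fm"
  unfolding close_fm_def linked_fm_def step_fm_def by simp

abbreviation models :: "nat \<Rightarrow> nat set set \<Rightarrow> nat set set \<Rightarrow> nat \<Rightarrow> (nat \<Rightarrow> nat) \<Rightarrow> fm \<Rightarrow> bool" where
  "models n E P \<equiv> holds n (\<lambda>i j. {i, j} \<in> E) (same P)"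

lemma models_step_fm:
  "models n E P d \<sigma> (step_fm Edge x y) \<longleftrightarrow> step E P (\<sigma> 0) (\<sigma> 1) (\<sigma> x) (\<sigma> y)"
  unfolding step_fm_def step_def by auto

text \<open>On the diagonal \<open>Non_edge\<close> holds although the complement has no edge there,
  but \<open>step\<close> accepts equal vertices anyway. The bounds supply membership in the vertex
  set.\<close>

lemma models_step_fm_complement:
  assumes "\<sigma> x < n" "\<sigma> y < n"
  shows "models n E P d \<sigma> (step_fm Non_edge x y) \<longleftrightarrow>
    step (edge_complement {..<n} E) P (\<sigma> 0) (\<sigma> 1) (\<sigma> x) (\<sigma> y)"
  using assms unfolding step_fm_def step_def mem_edge_complement_iff by auto

lemma models_linked_fm:
  "models n E P 2 \<sigma> (linked_fm Edge) \<longleftrightarrow> linked {..<n} E P (\<sigma> 0) (\<sigma> 1)"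
  unfolding linked_fm_def linked_def by (simp add: models_step_fm Bex_def del: ex_simps bex_simps)

lemma models_linked_fm_complement:
  assumes "\<sigma> 0 < n" "\<sigma> 1 < n"
  shows "models n E P 2 \<sigma> (linked_fm Non_edge) \<longleftrightarrow>
    linked {..<n} (edge_complement {..<n} E) P (\<sigma> 0) (\<sigma> 1)"
  unfolding linked_fm_def linked_def using assms
  \<comment> \<open>\<open>conj_cong\<close> passes the bounds of the quantified vertices to this
    conditional rule.\<close>
  by (simp add: models_step_fm_complement Bex_def cong: conj_cong del: ex_simps bex_simps)

lemma models_close_fm:
  assumes "i < n" "j < n"
  shows "models n E P 2 (pair_env i j) close_fm \<longleftrightarrow> {i, j} \<in> close_pairs {..<n} E P"
  unfolding close_fm_def mem_close_pairs_iff
  using assms by (auto simp: models_linked_fm models_linked_fm_complement)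

lemma models_agree_fm:
  assumes "i < n" "j < n"
  shows "models n E P 2 (pair_env i j) agree_fm \<longleftrightarrow> agree id {..<n} E P i j"
  unfolding agree_fm_def agree_def anchor_fm_def anchors_def
  using assms by (auto simp: Bex_def Ball_def)

lemma enc_matrix_cong:
  "(\<And>i j. i < n \<Longrightarrow> j < n \<Longrightarrow> Q i j = Q' i j) \<Longrightarrow> enc_matrix n Q = enc_matrix n Q'"
  unfolding enc_matrix_eq by (intro arg_cong[where f = concat] map_cong) auto

definition block :: "nat \<Rightarrow> nat set set \<Rightarrow> nat set set \<Rightarrow> nat list" where
  "block n E P = enc_matrix n (\<lambda>i j. models n E P 2 (pair_env i j) agree_fm) @
     enc_matrix n (\<lambda>i j. models n E P 2 (pair_env i j) close_fm)"

text \<open>The refined parts are never formed by the machine: the matrix of their equivalence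
  relation is that of \<open>agree\<close>, which \<open>agree_fm\<close> defines.\<close>

lemma enc_mseq_anchored_seq:
  assumes "\<And>P. P \<in> set Ps \<Longrightarrow> partition_on {..<n} P"
  shows "enc_mseq n (anchored_seq id {..<n} E Ps) = n # length Ps # concat (map (block n E) Ps)"
proof -
  have "enc_partition n (anchor_refinement id {..<n} E P) @ enc_edges n (close_pairs {..<n} E P)
      = block n E P" if "P \<in> set Ps" for P
    unfolding enc_partition_def enc_edges_def block_def
    using same_anchor_refinement[OF assms[OF that], of id E] models_agree_fm models_close_fm
    by (intro arg_cong2[where f = append] enc_matrix_cong) (simp_all add: same_def)
  then show ?thesis unfolding enc_mseq_def anchored_seq_def
    by (simp add: comp_def cong: map_cong)
qed

section \<open>Layout of the input\<close>

lemma length_concat_uniform: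
  "(\<And>x. x \<in> set xs \<Longrightarrow> length x = l) \<Longrightarrow> length (concat xs) = length xs * l"
  by (induction xs) auto

lemma nth_concat_uniform:
  "(\<And>x. x \<in> set xs \<Longrightarrow> length x = l) \<Longrightarrow> t < length xs \<Longrightarrow> k < l \<Longrightarrow>
    concat xs ! (t * l + k) = xs ! t ! k"
proof (induction xs arbitrary: t)
  case (Cons x xs)
  have "length x = l" using Cons.prems(1) by simp
  then show ?case
    using Cons by (cases t) (simp_all add: nth_append)
qed simp

lemma length_enc_matrix: "length (enc_matrix n Q) = n * n"
  unfolding enc_matrix_eq by (subst length_concat_uniform[of _ n]) auto

lemma nth_enc_matrix: "i < n \<Longrightarrow> j < n \<Longrightarrow> enc_matrix n Q ! (i * n + j) = of_bool (Q i j)"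
  unfolding enc_matrix_eq by (subst nth_concat_uniform[of _ n]) auto

lemma matrix_index_less: "i < n \<Longrightarrow> j < n \<Longrightarrow> i * n + j < n * (n :: nat)"
proof -
  assume "i < n" "j < n"
  then have "i * n + j < Suc i * n" by simp
  also have "\<dots> \<le> n * n" using \<open>i < n\<close> by (intro mult_le_mono1) simp
  finally show ?thesis .
qed

definition input_array :: "nat list \<Rightarrow> nat \<Rightarrow> nat" where
  "input_array xs i = (if i \<le> length xs then (length xs # xs) ! i else 0)"

lemma input_array_Suc: "p < length xs \<Longrightarrow> input_array xs (Suc p) = xs ! p"
  unfolding input_array_def by simp

lemma length_enc_instance:
  "length (enc_instance n E Ps) = 2 + n * n + length Ps * (n * n)"
proof -
  have "length (concat (map (enc_partition n) Ps)) = length Ps * (n * n)"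
    by (subst length_concat_uniform[of _ "n * n"]) (auto simp: enc_partition_def length_enc_matrix)
  then show ?thesis unfolding enc_instance_def enc_edges_def by (simp add: length_enc_matrix)
qed

text \<open>The offset \<open>3\<close> skips the length of the list, the number of vertices and the
  number of partitions.\<close>

lemma input_edges:
  assumes "i < n" "j < n"
  shows "input_array (enc_instance n E Ps) (i * n + j + 3) = of_bool ({i, j} \<in> E)"
proof -
  have l: "i * n + j < n * n" using assms by (rule matrix_index_less)
  have "input_array (enc_instance n E Ps) (Suc (i * n + j + 2)) = enc_instance n E Ps ! (i * n + j + 2)"
    by (rule input_array_Suc) (use l in \<open>simp add: length_enc_instance\<close>)
  also have "\<dots> = enc_edges n E ! (i * n + j)"
    using l unfolding enc_instance_def by (simp add: nth_append enc_edges_def length_enc_matrix)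
  also have "\<dots> = of_bool ({i, j} \<in> E)" using assms by (simp add: enc_edges_def nth_enc_matrix)
  also have "Suc (i * n + j + 2) = i * n + j + 3" by simp
  finally show ?thesis .
qed

lemma input_partition:
  assumes "i < n" "j < n" "t < length Ps"
  shows "input_array (enc_instance n E Ps) (i * n + j + (3 + n * n + t * (n * n))) =
    of_bool (same (Ps ! t) i j)"
proof -
  have l: "i * n + j < n * n" using assms(1,2) by (rule matrix_index_less)
  then have "t * (n * n) + (i * n + j) < Suc t * (n * n)" by simp
  also have "\<dots> \<le> length Ps * (n * n)" using assms(3) by (intro mult_le_mono1) simp
  finally have t: "t * (n * n) + (i * n + j) < length Ps * (n * n)" .
  let ?k = "n * n + (t * (n * n) + (i * n + j))"
  have "input_array (enc_instance n E Ps) (Suc (2 + ?k)) = enc_instance n E Ps ! (2 + ?k)"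
    by (rule input_array_Suc) (use t in \<open>simp add: length_enc_instance\<close>)
  also have "\<dots> = concat (map (enc_partition n) Ps) ! (t * (n * n) + (i * n + j))"
    unfolding enc_instance_def by (simp add: nth_append enc_edges_def length_enc_matrix)
  also have "\<dots> = enc_partition n (Ps ! t) ! (i * n + j)"
    using l assms(3)
    by (subst nth_concat_uniform[of _ "n * n"]) (auto simp: enc_partition_def length_enc_matrix)
  also have "\<dots> = of_bool (same (Ps ! t) i j)"
    using assms by (simp add: enc_partition_def nth_enc_matrix same_def)
  also have "Suc (2 + ?k) = i * n + j + (3 + n * n + t * (n * n))" by simp
  finally show ?thesis .
qed

section \<open>The program and its loop invariants\<close>

text \<open>Register \<open>4\<close> holds \<open>n * n\<close>, and register \<open>6\<close> the number of partitions not yet processed.\<close>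

definition emit_block :: ram where
  "emit_block = Seq (put_matrix agree_fm) (Seq (put_matrix close_fm)
     (Seq (Plus 3 3 4) (Minus 6 6 0)))"

text \<open>Register \<open>4\<close> runs through the multiples of \<open>n\<close> while the table
  is filled and ends as \<open>n * n\<close>, the distance between consecutive partition matrices.
  Register \<open>5\<close> starts behind the two header entries and the cell kept for the output
  length, which is known only at the end.\<close>

definition anchored_seq_prog :: ram where
  "anchored_seq_prog =
     Seq (Lit 0 1) (Seq (Load 1 0 0) (Seq (Lit 2 2) (Seq (Load 6 0 2) (Seq (Store 1 0 1)
     (Seq (Store 1 2 6) (Seq (Lit 5 3) (Seq (Lit 2 3) (Seq (Lit 4 0)
     (Seq (for_vertex (var 0) (cnt 0) (Seq (Store 2 (var 0) 4) (Plus 4 4 1)))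
     (Seq (Plus 3 2 4) (Seq (Loop 6 emit_block)
     (Seq (Minus 5 5 0) (Seq (Lit 7 0) (Store 1 7 5))))))))))))))"

definition put_cost :: "fm \<Rightarrow> nat poly" where
  "put_cost \<phi> = [:0, 1:] * ([:0, 1:] * (cost \<phi> + [:7:]) + [:6:]) + [:3:]"

definition block_cost :: "nat poly" where
  "block_cost = put_cost agree_fm + put_cost close_fm + [:2:]"

text \<open>To be evaluated at the input size, which bounds both the number of vertices and the
  number of partitions.\<close>

definition prog_cost :: "nat poly" where
  "prog_cost = [:0, 1:] * (block_cost + [:6:]) + [:17:]"

definition written :: "nat \<Rightarrow> nat set set \<Rightarrow> nat set set list \<Rightarrow> nat \<Rightarrow> nat list" where
  "written n E Ps t = n # length Ps # concat (map (block n E) (take t Ps))"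

definition after_blocks :: "nat \<Rightarrow> nat set set \<Rightarrow> nat set set list \<Rightarrow> nat \<Rightarrow> ram_state \<Rightarrow> bool" where
  "after_blocks n E Ps t = (\<lambda>(\<rho>, \<mu>). \<rho> 0 = 1 \<and> \<rho> 1 = n \<and> \<rho> 2 = 3 \<and>
     \<rho> 3 = 3 + n * n + t * (n * n) \<and> \<rho> 4 = n * n \<and> \<rho> 6 = length Ps - t \<and>
     \<mu> 0 = input_array (enc_instance n E Ps) \<and> (\<forall>i<n. \<mu> 2 i = i * n) \<and>
     \<rho> 5 = Suc (length (written n E Ps t)) \<and>
     (\<forall>i<length (written n E Ps t). \<mu> 1 (Suc i) = written n E Ps t ! i))"

lemma written_Suc: "t < length Ps \<Longrightarrow> written n E Ps (Suc t) = written n E Ps t @ block n E (Ps ! t)"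
  unfolding written_def by (simp add: take_Suc_conv_app_nth)

lemma halts_emit_block:
  assumes "t < length Ps" and J: "after_blocks n E Ps t (\<rho>, \<mu>)"
  shows "halts emit_block (\<rho>, \<mu>) (poly block_cost n) (after_blocks n E Ps (Suc t))"
proof -
  have 0: "\<rho> 0 = 1" "\<rho> 1 = n" "\<rho> 2 = 3" "\<rho> 3 = 3 + n * n + t * (n * n)"
    and mem: "\<mu> 0 = input_array (enc_instance n E Ps)" "\<And>i. i < n \<Longrightarrow> \<mu> 2 i = i * n"
    using J unfolding after_blocks_def by auto
  have rd: "ready n (\<lambda>i j. {i, j} \<in> E) (same (Ps ! t)) \<rho> \<mu>"
    unfolding ready_def 0 mem(1) using mem(2) input_edges input_partition assms(1) by simp
  have em: "emitted \<rho> \<mu> (written n E Ps t) (\<rho>, \<mu>)"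
    using J unfolding emitted_def after_blocks_def by simp
  have tail: "halts (Seq (Plus 3 3 4) (Minus 6 6 0)) s 2 (after_blocks n E Ps (Suc t))"
    if "emitted \<rho> \<mu> (written n E Ps (Suc t)) s" for s
  proof -
    obtain \<rho>' \<mu>' where s: "s = (\<rho>', \<mu>')" by (cases s)
    have "after_blocks n E Ps (Suc t) (\<rho>'(3 := \<rho>' 3 + \<rho>' 4, 6 := \<rho>' 6 - \<rho>' 0), \<mu>')"
      using that J unfolding s emitted_def after_blocks_def by (simp add: algebra_simps)
    then show ?thesis unfolding s by (intro halts_Seq_step halts_Plus halts_Minus) simp_all
  qed
  have "halts emit_block (\<rho>, \<mu>) (poly (put_cost agree_fm) n + (poly (put_cost close_fm) n + 2))
    (after_blocks n E Ps (Suc t))"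
    unfolding emit_block_def
  proof (rule halts_Seq, rule halts_mono[OF halts_put_matrix[OF closed_agree_fm rd em]], goal_cases)
    case 1
    then show ?case by (simp add: put_cost_def algebra_simps)
  next
    \<comment> \<open>Both matrices are described relative to the state at the start of the block,
      so \<open>rd\<close> serves the second one as well.\<close>
    case (2 s)
    obtain \<rho>' \<mu>' where s: "s = (\<rho>', \<mu>')" by (cases s)
    show ?case
      by (rule halts_Seq, unfold s, rule halts_mono[OF halts_put_matrix[OF closed_close_fm rd 2[unfolded s]]])
        (simp add: put_cost_def algebra_simps,
          rule tail, simp add: written_Suc[OF assms(1)] block_def)
  qed
  then show ?thesis unfolding block_cost_def by (simp add: add.assoc)
qed

lemma halts_blocks:
  "t \<le> length Ps \<Longrightarrow> after_blocks n E Ps t s \<Longrightarrow>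
    halts (Loop 6 emit_block) s ((length Ps - t) * (poly block_cost n + 1) + 1)
      (after_blocks n E Ps (length Ps))"
proof (induction "length Ps - t" arbitrary: t s)
  case 0
  then show ?case by (intro halts_Loop_exit) (auto simp: after_blocks_def)
next
  case (Suc d)
  obtain \<rho> \<mu> where s: "s = (\<rho>, \<mu>)" by (cases s)
  have t: "t < length Ps" using Suc.hyps(2) by simp
  have "halts (Loop 6 emit_block) s (Suc (poly block_cost n +
      ((length Ps - Suc t) * (poly block_cost n + 1) + 1))) (after_blocks n E Ps (length Ps))"
  proof (rule halts_Loop_step)
    show "fst s 6 \<noteq> 0" using Suc.prems t unfolding s after_blocks_def by simp
    show "halts emit_block s (poly block_cost n) (\<lambda>s'. halts (Loop 6 emit_block) s'
      ((length Ps - Suc t) * (poly block_cost n + 1) + 1) (after_blocks n E Ps (length Ps)))"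
      unfolding s
    proof (rule halts_mono[OF halts_emit_block[OF t Suc.prems(2)[unfolded s]] order_refl])
      fix s' assume "after_blocks n E Ps (Suc t) s'"
      then show "halts (Loop 6 emit_block) s' ((length Ps - Suc t) * (poly block_cost n + 1) + 1)
        (after_blocks n E Ps (length Ps))"
        using Suc.hyps(1)[of "Suc t" s'] Suc.hyps(2) t by simp
    qed
  qed
  moreover have "length Ps - t = Suc (length Ps - Suc t)" using t by simp
  ultimately show ?case by (simp only: mult_Suc) (erule halts_mono, simp_all)
qed

lemma halts_Lit_Seq:
  "halts c' (\<rho>(x := c), \<mu>) T Q \<Longrightarrow> halts (Seq (Lit x c) c') (\<rho>, \<mu>) (Suc T) Q"
  by (intro halts_Seq_step halts_Lit) simp_all

lemma halts_Load_Seq: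
  "halts c' (\<rho>(x := \<mu> a (\<rho> y)), \<mu>) T Q \<Longrightarrow> halts (Seq (Load x a y) c') (\<rho>, \<mu>) (Suc T) Q"
  by (intro halts_Seq_step halts_Load) simp_all

lemma halts_Store_Seq:
  "halts c' (\<rho>, \<mu>(a := (\<mu> a)(\<rho> x := \<rho> y))) T Q \<Longrightarrow> halts (Seq (Store a x y) c') (\<rho>, \<mu>) (Suc T) Q"
  by (intro halts_Seq_step halts_Store) simp_all

lemma halts_anchored_seq_prog:
  "halts anchored_seq_prog (ram_input (enc_instance n E Ps))
     (n * 5 + length Ps * (poly block_cost n + 1) + 17)
     (\<lambda>(\<rho>, \<mu>). \<forall>i \<le> length (written n E Ps (length Ps)).
       \<mu> 1 i = (length (written n E Ps (length Ps)) # written n E Ps (length Ps)) ! i)"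
  (is "halts _ _ _ ?Q")
proof -
  let ?in = "input_array (enc_instance n E Ps)"
  let ?m = "length Ps"
  \<comment> \<open>The state after the nine initial instructions. Register \<open>2\<close> first
    holds the address of the number of partitions, then that of the edge matrix.\<close>
  define \<rho> :: "nat \<Rightarrow> nat" where "\<rho> = (\<lambda>_. 0)(0 := 1, 1 := n, 2 := 2, 6 := ?m, 5 := 3, 2 := 3, 4 := 0)"
  define \<mu> :: "nat \<Rightarrow> nat \<Rightarrow> nat" where "\<mu> = (\<lambda>a. if a = 0 then ?in else (\<lambda>_. 0))
    (1 := (\<lambda>_. 0)(1 := n, 2 := ?m))"
  define I :: "nat \<Rightarrow> ram_state \<Rightarrow> bool" where "I k = (\<lambda>(\<rho>', \<mu>'). \<rho>' 0 = 1 \<and> \<rho>' 1 = n \<and> \<rho>' 2 = 3 \<and> \<rho>' 4 = k * n \<and>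
    \<rho>' 5 = 3 \<and> \<rho>' 6 = ?m \<and> \<mu>' 0 = ?in \<and> \<mu>' 1 = \<mu> 1 \<and> (\<forall>i<k. \<mu>' 2 i = i * n))" for k
  have table: "halts (for_vertex (var 0) (cnt 0) (Seq (Store 2 (var 0) 4) (Plus 4 4 1))) (\<rho>, \<mu>)
    (n * (2 + 3) + 3) (I n)"
  proof (rule halts_for_vertex)
    fix k and \<rho>' :: "nat \<Rightarrow> nat" and \<mu>' assume k: "k < n" "\<rho>' (var 0) = k" "I k (\<rho>', \<mu>')"
    have "I (Suc k) (\<rho>'(4 := \<rho>' 4 + \<rho>' 1), \<mu>'(2 := (\<mu>' 2)(\<rho>' (var 0) := \<rho>' 4)))"
      using k unfolding I_def by (simp add: less_Suc_eq)
    then show "halts (Seq (Store 2 (var 0) 4) (Plus 4 4 1)) (\<rho>', \<mu>') 2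
      (\<lambda>(\<rho>', \<mu>'). \<rho>' (var 0) = k \<and> I (Suc k) (\<rho>', \<mu>'))"
      using k(2) by (intro halts_Seq_step halts_Store halts_Plus) simp_all
  qed (auto simp: I_def \<rho>_def \<mu>_def)
  have finish: "halts (Seq (Minus 5 5 0) (Seq (Lit 7 0) (Store 1 7 5))) s 3 ?Q"
    if "after_blocks n E Ps ?m s" for s
  proof -
    obtain \<rho>' \<mu>' where s: "s = (\<rho>', \<mu>')" by (cases s)
    have "?Q (\<rho>'(5 := \<rho>' 5 - \<rho>' 0, 7 := 0), \<mu>'(1 := (\<mu>' 1)(0 := \<rho>' 5 - \<rho>' 0)))"
      using that unfolding s after_blocks_def by (auto simp: nth_Cons split: nat.split)
    then show ?thesis unfolding s
      by (intro halts_Seq_step halts_Minus halts_Lit halts_Store) simp_all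
  qed
  have rest: "halts (Seq (Plus 3 2 4) (Seq (Loop 6 emit_block)
      (Seq (Minus 5 5 0) (Seq (Lit 7 0) (Store 1 7 5))))) s
      (1 + (?m * (poly block_cost n + 1) + 1 + 3)) ?Q" if "I n s" for s
  proof -
    obtain \<rho>' \<mu>' where s: "s = (\<rho>', \<mu>')" by (cases s)
    have "after_blocks n E Ps 0 (\<rho>'(3 := \<rho>' 2 + \<rho>' 4), \<mu>')"
      using that unfolding s I_def after_blocks_def written_def \<mu>_def
      by (auto simp: less_Suc_eq numeral_2_eq_2)
    from halts_blocks[OF _ this]
    have "halts (Loop 6 emit_block) (\<rho>'(3 := \<rho>' 2 + \<rho>' 4), \<mu>') (?m * (poly block_cost n + 1) + 1)
      (\<lambda>s. halts (Seq (Minus 5 5 0) (Seq (Lit 7 0) (Store 1 7 5))) s 3 ?Q)"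
      by (rule halts_mono[OF _ _ finish]) simp_all
    then show ?thesis unfolding s by (intro halts_Seq halts_Plus) simp_all
  qed
  have "halts (Seq (for_vertex (var 0) (cnt 0) (Seq (Store 2 (var 0) 4) (Plus 4 4 1)))
     (Seq (Plus 3 2 4) (Seq (Loop 6 emit_block)
     (Seq (Minus 5 5 0) (Seq (Lit 7 0) (Store 1 7 5)))))) (\<rho>, \<mu>)
     ((n * (2 + 3) + 3) + (1 + (?m * (poly block_cost n + 1) + 1 + 3))) ?Q"
    by (rule halts_Seq, rule halts_mono[OF table order_refl rest])
  moreover have "?in 1 = n" "?in 2 = ?m" unfolding enc_instance_def input_array_def by simp_all
  moreover have "ram_input (enc_instance n E Ps) = ((\<lambda>_. 0), (\<lambda>a. if a = 0 then ?in else (\<lambda>_. 0)))"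
    unfolding ram_input_def input_array_def by (auto simp: fun_eq_iff)
  ultimately have "halts anchored_seq_prog (ram_input (enc_instance n E Ps))
     (Suc (Suc (Suc (Suc (Suc (Suc (Suc (Suc (Suc ((n * (2 + 3) + 3) +
       (1 + (?m * (poly block_cost n + 1) + 1 + 3)))))))))))) ?Q"
    unfolding anchored_seq_prog_def
    by (simp only:) (intro halts_Lit_Seq halts_Load_Seq halts_Store_Seq, simp add: \<rho>_def \<mu>_def)
  then show ?thesis by (rule halts_mono) simp_all
qed

section \<open>Running time in terms of the bit size\<close>

lemma poly_nat_mono: "x \<le> y \<Longrightarrow> poly p x \<le> poly p (y :: nat)"
  by (induction p) (auto intro: add_mono mult_mono)

lemma length_le_bit_size: "length xs \<le> bit_size xs"
  unfolding bit_size_def by (induction xs) auto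

lemma computes_anchored_seq:
  assumes "fin_graph {..<n} E" "partition_seq {..<n} Ps"
  obtains t where "ram_computes anchored_seq_prog (enc_instance n E Ps) t
      (enc_mseq n (anchored_seq id {..<n} E Ps))"
    "t \<le> poly prog_cost (bit_size (enc_instance n E Ps))"
proof -
  let ?N = "bit_size (enc_instance n E Ps)"
  let ?ys = "written n E Ps (length Ps)"
  have ys: "enc_mseq n (anchored_seq id {..<n} E Ps) = ?ys"
    using assms(2) unfolding partition_seq_def written_def by (simp add: enc_mseq_anchored_seq)
  obtain t \<rho> \<mu> where t: "ram_exec anchored_seq_prog (ram_input (enc_instance n E Ps)) t (\<rho>, \<mu>)"
    "t \<le> n * 5 + length Ps * (poly block_cost n + 1) + 17"
    "\<forall>i \<le> length ?ys. \<mu> 1 i = (length ?ys # ?ys) ! i"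
    using halts_anchored_seq_prog unfolding halts_def by fast
  have "n > 0" using assms(1) unfolding fin_graph_def by auto
  \<comment> \<open>The matrices are nonempty, so the length of the input bounds both
    \<open>n\<close> and the number of partitions; every entry has at least one digit.\<close>
  then have "n \<le> n * n" "length Ps \<le> length Ps * (n * n)" by simp_all
  then have N: "n \<le> ?N" "length Ps \<le> ?N"
    using length_le_bit_size[of "enc_instance n E Ps"] unfolding length_enc_instance by linarith+
  have "length Ps * (poly block_cost n + 1) \<le> ?N * (poly block_cost ?N + 1)"
    by (intro mult_le_mono add_le_mono poly_nat_mono N order_refl)
  then have "t \<le> poly prog_cost ?N"
    using t(2) N(1) unfolding prog_cost_def by (simp add: algebra_simps)
  then show thesis using that t(1,3) unfolding ram_computes_def ys by blast
qed

theorem theorem5p1: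
  shows "(\<forall>(V :: 'a set) E r k. fin_graph V E \<and> pmw (6 * r + 1) V E = k \<longrightarrow>
            mw r V E \<le> k * nbhd_complexity V E k \<and>
            (\<exists>S. merge_seq V E S \<and> firm 6 V E S \<and>
                 merge_seq_width r V S \<le> k * nbhd_complexity V E k))
       \<and> (\<exists>(prog :: ram) (p :: nat poly). \<forall>n E r k Ps.
            fin_graph {..<n} E \<and> pmw (6 * r + 1) {..<n} E = k \<and>
            partition_seq {..<n} Ps \<and> partition_seq_width (6 * r + 1) {..<n} E Ps \<le> k \<longrightarrow>
            (\<exists>S t. merge_seq {..<n} E S \<and> firm 6 {..<n} E S \<and>
                 merge_seq_width r {..<n} S \<le> k * nbhd_complexity {..<n} E k \<and>
                 ram_computes prog (enc_instance n E Ps) t (enc_mseq n S) \<and>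
                 t \<le> poly p (bit_size (enc_instance n E Ps))))"
proof (rule conjI)
  show "\<forall>(V :: 'a set) E r k. fin_graph V E \<and> pmw (6 * r + 1) V E = k \<longrightarrow>
            mw r V E \<le> k * nbhd_complexity V E k \<and>
            (\<exists>S. merge_seq V E S \<and> firm 6 V E S \<and>
                 merge_seq_width r V S \<le> k * nbhd_complexity V E k)"
  proof (intro allI impI, elim conjE)
    fix V :: "'a set" and E r k assume E: "fin_graph V E" and "pmw (6 * r + 1) V E = k"
    then obtain Ps where Ps: "partition_seq V Ps" "partition_seq_width (6 * r + 1) V E Ps = k"
      by (rule pmw_witness)
    \<comment> \<open>The type of vertices carries no order, so an arbitrary numbering selects the
      anchors.\<close>
    obtain f :: "'a \<Rightarrow> nat" where "inj_on f V"
      using E finite_imp_inj_to_nat_seg[of V] unfolding fin_graph_def by auto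
    then have S: "merge_seq V E (anchored_seq f V E Ps)" "firm 6 V E (anchored_seq f V E Ps)"
      "merge_seq_width r V (anchored_seq f V E Ps) \<le> k * nbhd_complexity V E k"
      using merge_seq_anchored_seq[OF E Ps(1)] firm_anchored_seq[OF E Ps(1)]
        width_anchored_seq[OF E Ps(1)] Ps(2) by blast+
    have "mw r V E \<le> merge_seq_width r V (anchored_seq f V E Ps)"
      unfolding mw_def using S(1) by (intro Least_le) blast
    then show "mw r V E \<le> k * nbhd_complexity V E k \<and>
            (\<exists>S. merge_seq V E S \<and> firm 6 V E S \<and>
                 merge_seq_width r V S \<le> k * nbhd_complexity V E k)"
      using S order_trans by blast
  qed
  show "\<exists>(prog :: ram) (p :: nat poly). \<forall>n E r k Ps.
            fin_graph {..<n} E \<and> pmw (6 * r + 1) {..<n} E = k \<and>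
            partition_seq {..<n} Ps \<and> partition_seq_width (6 * r + 1) {..<n} E Ps \<le> k \<longrightarrow>
            (\<exists>S t. merge_seq {..<n} E S \<and> firm 6 {..<n} E S \<and>
                 merge_seq_width r {..<n} S \<le> k * nbhd_complexity {..<n} E k \<and>
                 ram_computes prog (enc_instance n E Ps) t (enc_mseq n S) \<and>
                 t \<le> poly p (bit_size (enc_instance n E Ps)))"
  \<comment> \<open>The construction refers to neither \<open>r\<close> nor \<open>k\<close>, so one
    program and one polynomial serve all of them.\<close>
  proof (intro exI[of _ anchored_seq_prog] exI[of _ prog_cost] allI impI, elim conjE)
    fix n r k :: nat and E Ps
    assume E: "fin_graph {..<n} E" and Ps: "partition_seq {..<n} Ps"
      and w: "partition_seq_width (6 * r + 1) {..<n} E Ps \<le> k"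
    obtain t where "ram_computes anchored_seq_prog (enc_instance n E Ps) t
        (enc_mseq n (anchored_seq id {..<n} E Ps))"
      "t \<le> poly prog_cost (bit_size (enc_instance n E Ps))"
      by (rule computes_anchored_seq[OF E Ps])
    then show "\<exists>S t. merge_seq {..<n} E S \<and> firm 6 {..<n} E S \<and>
                 merge_seq_width r {..<n} S \<le> k * nbhd_complexity {..<n} E k \<and>
                 ram_computes anchored_seq_prog (enc_instance n E Ps) t (enc_mseq n S) \<and>
                 t \<le> poly prog_cost (bit_size (enc_instance n E Ps))"
      using merge_seq_anchored_seq[OF E Ps] firm_anchored_seq[OF E Ps]
        width_anchored_seq[OF E Ps inj_on_id w] by blast
  qed
qed

end
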